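(* Let $G$ be a finite abelian group. Then: (i) if $\operatorname{diam}^+(G)\ge1$, then $t_1(G)=0$ and $s_1(G)=|G|$; (ii) if $\operatorname{diam}^+(G)\ge 2$, then $t_2(G)=s_2(G)=|G|-1$; (iii) if $\operatorname{diam}^+(G)\ge 3$, then $t_3(G)=s_3(G)=\lfloor |G|/2\rfloor$; (iv) if $\rho=\operatorname{diam}^+(G)\ge 2$, then $t_\rho(G)=s_\rho(G)=\operatorname{rk}(G)+1$.
   Context: Groups are written additively; $\operatorname{rk}(G)$ is the minimal number of generators of $G$. For $A\subseteq G$ let $A_0:=A\cup\{0\}$ and $\langle A\rangle^+_\rho:=\rho A_0=\{a_1+\dots+a_\rho:a_i\in A_0\}$. $\operatorname{diam}^+_A(G):=\min\{\rho\in\mathbb{N}_0:\langle A\rangle^+_\rho=G\}$ ($\min\varnothing=\infty$); $\operatorname{diam}^+(G):=\max\{\operatorname{diam}^+_A(G):\langle A\rangle=G\}$. The period of $S\subseteq G$ is $\pi(S):=\{g\in G:S+g=S\}$; $S$ is aperiodic if $\pi(S)=\{0\}$ and periodic otherwise. A subset $A\subseteq G$ is $\rho$-maximal if it is maximal under inclusion subject to $\operatorname{diam}^+_A(G)\ge\rho$, i.e. subject to $\langle A\rangle^+_{\rho-1}\neq G$. With the convention $\max\varnothing=0$: $s_\rho(G):=\max\{|A|: A\subseteq G,\ \rho\le\operatorname{diam}^+_A(G)<\infty\}$ and $t_\rho(G):=\max\{|A|: A \text{ is an aperiodic } \rho\text{-maximal generating set for } G\}$. *)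

theory Defs
  imports Main "HOL-Library.Extended_Nat"
begin

text \<open>The finite abelian group G is the whole (finite) type 'a, written additively.\<close>

definition sumset :: "'a::comm_monoid_add set \<Rightarrow> nat \<Rightarrow> 'a set" where
  "sumset A \<rho> = {sum_list xs | xs. length xs = \<rho> \<and> set xs \<subseteq> insert 0 A}"

definition gen :: "'a::ab_group_add set \<Rightarrow> 'a set" where
  "gen A = \<Inter>{H. A \<subseteq> H \<and> 0 \<in> H \<and> (\<forall>x\<in>H. \<forall>y\<in>H. x + y \<in> H) \<and> (\<forall>x\<in>H. - x \<in> H)}"

definition generates :: "'a::ab_group_add set \<Rightarrow> bool" where
  "generates A \<longleftrightarrow> gen A = UNIV"

definition diamA :: "'a::ab_group_add set \<Rightarrow> enat" where
  "diamA A = (if \<exists>\<rho>. sumset A \<rho> = UNIV then enat (LEAST \<rho>. sumset A \<rho> = UNIV) else \<infinity>)"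

definition diam_plus :: "'a::{ab_group_add,finite} itself \<Rightarrow> enat" where
  "diam_plus _ = Max {diamA (A::'a set) | A. generates A}"

definition rk :: "'a::{ab_group_add,finite} itself \<Rightarrow> nat" where
  "rk _ = (LEAST n. \<exists>A::'a set. card A = n \<and> generates A)"

definition period :: "'a::ab_group_add set \<Rightarrow> 'a set" where
  "period S = {g. (\<lambda>x. x + g) ` S = S}"

definition aperiodic :: "'a::ab_group_add set \<Rightarrow> bool" where
  "aperiodic S \<longleftrightarrow> period S = {0}"

definition rho_maximal :: "nat \<Rightarrow> 'a::ab_group_add set \<Rightarrow> bool" where
  "rho_maximal \<rho> A \<longleftrightarrow> enat \<rho> \<le> diamA A \<and> (\<forall>B. A \<subset> B \<longrightarrow> \<not> enat \<rho> \<le> diamA B)"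

text \<open>s_rho(G) and t_rho(G), with max of the empty set = 0.\<close>
definition s_rho :: "'a::{ab_group_add,finite} itself \<Rightarrow> nat \<Rightarrow> nat" where
  "s_rho _ \<rho> = Max ({card (A::'a set) | A. enat \<rho> \<le> diamA A \<and> diamA A < \<infinity>} \<union> {0})"

definition t_rho :: "'a::{ab_group_add,finite} itself \<Rightarrow> nat \<Rightarrow> nat" where
  "t_rho _ \<rho> = Max ({card (A::'a set) | A. aperiodic A \<and> rho_maximal \<rho> A \<and> generates A} \<union> {0})"

end

theory Submission
  imports Defs Complex_Main "HOL-Computational_Algebra.Primes" "HOL-Library.FuncSet"
begin

text \<open>For (iv), enumerate a generating set as \<open>a\<^sub>1, \<dots>, a\<^sub>n\<close> and let
  \<open>d\<^sub>i\<close> be the order of \<open>a\<^sub>i\<close> modulo the span of its predecessors, so that every element is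
  \<open>\<Sum> x\<^sub>i a\<^sub>i\<close> with \<open>x\<^sub>i < d\<^sub>i\<close> and the diameter is at most \<open>\<Sum> (d\<^sub>i - 1)\<close>. A basis with orders
  \<open>m\<^sub>1, m\<^sub>2, \<dots>\<close>, each dividing the one before it, has diameter exactly \<open>\<Sum> (m\<^sub>i - 1)\<close>. Counting \<open>m\<^sub>k G\<close> shows that
  any \<open>k\<close> of the \<open>d\<^sub>i\<close> have product at most that of the \<open>k\<close> largest \<open>m\<^sub>i\<close>, and convexity gives
  \<open>\<Sum> (d\<^sub>i - 1) \<le> \<Sum> (m\<^sub>i - 1)\<close>. If \<open>n\<close> exceeds the rank, the inequality is strict unless some
  \<open>d\<^sub>i = 1\<close>, and then the redundant \<open>a\<^sub>i\<close> shortens the only element of full length.\<close>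

section \<open>Multiples, subgroups and relative orders\<close>

primrec nmul :: "nat \<Rightarrow> 'a::ab_group_add \<Rightarrow> 'a" where
  "nmul 0 x = 0"
| "nmul (Suc n) x = x + nmul n x"

lemma nmul_0_right [simp]: "nmul n 0 = 0"
  by (induction n) auto

lemma nmul_1 [simp]: "nmul (Suc 0) x = x"
  by simp

lemma nmul_add: "nmul (m + n) x = nmul m x + nmul n x"
  by (induction m) (auto simp: algebra_simps)

lemma nmul_nmul: "nmul m (nmul n x) = nmul (m * n) x"
  by (induction m) (auto simp: nmul_add)

lemma nmul_div_mod: "nmul m x = nmul (m div d * d) x + nmul (m mod d) x"
  using nmul_add[of "m div d * d" "m mod d" x] by simp

lemma nmul_plus: "nmul n (x + y) = nmul n x + nmul n y"
  by (induction n) (auto simp: algebra_simps)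

lemma nmul_diff: "nmul n (x - y) = nmul n x - nmul n y"
  by (induction n) (auto simp: algebra_simps)

lemma nmul_sum: "nmul n (sum f S) = (\<Sum>i\<in>S. nmul n (f i))"
  by (induction S rule: infinite_finite_induct) (auto simp: nmul_plus)

lemma nmul_diff_left: "n \<le> m \<Longrightarrow> nmul (m - n) x = nmul m x - nmul n x"
  using nmul_add[of "m - n" n x] by simp

definition subgrp :: "'a::ab_group_add set \<Rightarrow> bool" where
  "subgrp H \<longleftrightarrow> 0 \<in> H \<and> (\<forall>x\<in>H. \<forall>y\<in>H. x + y \<in> H) \<and> (\<forall>x\<in>H. - x \<in> H)"

lemma generates_iff: "generates A \<longleftrightarrow> (\<forall>H. A \<subseteq> H \<and> subgrp H \<longrightarrow> H = UNIV)"
  unfolding generates_def gen_def subgrp_def by blast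

lemma subgrp_0: "subgrp H \<Longrightarrow> 0 \<in> H"
  and subgrp_add: "subgrp H \<Longrightarrow> x \<in> H \<Longrightarrow> y \<in> H \<Longrightarrow> x + y \<in> H"
  and subgrp_minus: "subgrp H \<Longrightarrow> x \<in> H \<Longrightarrow> - x \<in> H"
  by (auto simp: subgrp_def)

lemma subgrp_diff: "subgrp H \<Longrightarrow> x \<in> H \<Longrightarrow> y \<in> H \<Longrightarrow> x - y \<in> H"
  using subgrp_add[of H x "- y"] subgrp_minus[of H y] by auto

lemma subgrp_nmul: "subgrp H \<Longrightarrow> x \<in> H \<Longrightarrow> nmul n x \<in> H"
  by (induction n) (auto simp: subgrp_0 subgrp_add)

lemma subgrp_add_cancel_left:
  "subgrp H \<Longrightarrow> x \<in> H \<Longrightarrow> x + y \<in> H \<longleftrightarrow> y \<in> H"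
  using subgrp_add[of H x y] subgrp_diff[of H "x + y" x] by auto

lemma subgrp_add_cancel_right:
  "subgrp H \<Longrightarrow> y \<in> H \<Longrightarrow> x + y \<in> H \<longleftrightarrow> x \<in> H"
  using subgrp_add_cancel_left[of H y x] by (simp add: add.commute)

lemma nmul_eq_0_exists: "\<exists>n>0. nmul n (x :: 'a::{ab_group_add,finite}) = 0"
proof -
  have "\<not> inj (\<lambda>n. nmul n x)"
    using finite_imageD infinite_UNIV_nat finite by blast
  then obtain i j where "i \<noteq> j" "nmul i x = nmul j x"
    by (auto simp: inj_def)
  then obtain i j where "i < j" "nmul i x = nmul j x"
    by (metis nat_neq_iff)
  thus ?thesis
    using nmul_diff_left[of i j x] by (intro exI[of _ "j - i"]) auto
qed

text \<open>Every element has finite order, so \<open>- x\<close> is a natural multiple of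
  \<open>x\<close>, and closure under negation follows from closure under addition.\<close>

lemma subgrpI_finite:
  fixes H :: "'a::{ab_group_add,finite} set"
  assumes "0 \<in> H" "\<And>x y. x \<in> H \<Longrightarrow> y \<in> H \<Longrightarrow> x + y \<in> H"
  shows "subgrp H"
proof -
  have "- x \<in> H" if "x \<in> H" for x
  proof -
    have mult: "nmul n x \<in> H" for n
      by (induction n) (auto simp: assms that)
    obtain n where "nmul (Suc n) x = 0"
      using nmul_eq_0_exists[of x] by (metis gr0_conv_Suc)
    hence "- x = nmul n x"
      by (simp add: neg_eq_iff_add_eq_0)
    thus ?thesis using mult by simp
  qed
  thus ?thesis using assms by (auto simp: subgrp_def)
qed

text \<open>For a subgroup \<open>H\<close> this is the order of the coset of \<open>x\<close> in
  the quotient by \<open>H\<close>; working with representatives avoids a quotient type.\<close>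

definition relord :: "'a::ab_group_add set \<Rightarrow> 'a \<Rightarrow> nat" where
  "relord H x = (LEAST d. d > 0 \<and> nmul d x \<in> H)"

context
  fixes H :: "'a::{ab_group_add,finite} set"
  assumes H: "subgrp H"
begin

lemma relord_pos: "relord H x > 0" and nmul_relord: "nmul (relord H x) x \<in> H"
proof -
  obtain n where "n > 0" "nmul n x = 0"
    using nmul_eq_0_exists by blast
  hence "\<exists>d>0. nmul d x \<in> H"
    using subgrp_0[OF H] by metis
  hence "relord H x > 0 \<and> nmul (relord H x) x \<in> H"
    unfolding relord_def by (rule LeastI_ex)
  thus "relord H x > 0" "nmul (relord H x) x \<in> H" by auto
qed

text \<open>Division with remainder: the multiple of \<open>x\<close> by the remainder lies in
  \<open>H\<close> as well, and minimality of the order makes the remainder zero.\<close>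

lemma nmul_mem_iff: "nmul m x \<in> H \<longleftrightarrow> relord H x dvd m"
proof
  let ?d = "relord H x"
  assume m: "nmul m x \<in> H"
  have "nmul m x = nmul (m div ?d) (nmul ?d x) + nmul (m mod ?d) x"
    unfolding nmul_nmul by (rule nmul_div_mod)
  hence "nmul (m mod ?d) x \<in> H"
    using m subgrp_add_cancel_left[OF H subgrp_nmul[OF H nmul_relord]] by metis
  moreover have "\<not> (m mod ?d > 0 \<and> nmul (m mod ?d) x \<in> H)"
    using not_less_Least[of "m mod ?d" "\<lambda>d. d > 0 \<and> nmul d x \<in> H"] relord_pos[of x]
    by (fold relord_def) simp
  ultimately have "m mod ?d = 0" by simp
  thus "?d dvd m" by auto
next
  assume "relord H x dvd m"
  then obtain k where "m = k * relord H x" by (metis dvdE mult.commute)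
  thus "nmul m x \<in> H"
    using subgrp_nmul[OF H nmul_relord, of k x] by (simp add: nmul_nmul)
qed

lemma relord_eqI: "(\<And>m. nmul m x \<in> H \<longleftrightarrow> d dvd m) \<Longrightarrow> relord H x = d"
  using nmul_mem_iff[of "relord H x" x] nmul_mem_iff[of d x] by (intro dvd_antisym) auto

lemma relord_nmul:
  assumes "relord H x = k * l"
  shows "relord H (nmul k x) = l"
proof (rule relord_eqI)
  fix m
  have "k > 0" using relord_pos[of x] assms by (cases k) auto
  have "nmul m (nmul k x) \<in> H \<longleftrightarrow> l * k dvd m * k"
    by (simp only: nmul_nmul nmul_mem_iff assms mult.commute[of k l])
  thus "nmul m (nmul k x) \<in> H \<longleftrightarrow> l dvd m"
    using \<open>k > 0\<close> by simp
qed

text \<open>Multiplying by the order of one summand removes that summand modulo \<open>H\<close>;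
  coprimality then cancels this factor from the divisibility obtained for the other.\<close>

lemma relord_add_coprime:
  assumes "coprime (relord H x) (relord H y)"
  shows "relord H (x + y) = relord H x * relord H y"
proof (rule relord_eqI, rule iffI)
  fix m assume m: "nmul m (x + y) \<in> H"
  have *: "relord H v dvd m"
    if "coprime (relord H u) (relord H v)" "nmul m (u + v) \<in> H" for u v
  proof -
    let ?k = "relord H u"
    have "nmul ?k (nmul m (u + v)) \<in> H"
      using that H subgrp_nmul by blast
    moreover have "nmul ?k (nmul m (u + v)) = nmul (?k * m) u + nmul (?k * m) v"
      by (simp add: nmul_nmul nmul_plus)
    moreover have "nmul (?k * m) u \<in> H" by (simp add: nmul_mem_iff)
    ultimately have "nmul (?k * m) v \<in> H"
      by (simp add: subgrp_add_cancel_left[OF H])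
    thus ?thesis
      using that(1) coprime_commute[of ?k] by (simp add: nmul_mem_iff coprime_dvd_mult_right_iff)
  qed
  have "relord H y dvd m" using *[of x y] assms m by blast
  moreover have "relord H x dvd m"
    using *[of y x] assms m by (metis coprime_commute add.commute)
  ultimately show "relord H x * relord H y dvd m"
    using assms by (simp add: divides_mult)
next
  fix m assume "relord H x * relord H y dvd m"
  hence "relord H x dvd m" "relord H y dvd m"
    by (rule dvd_mult_left, rule dvd_mult_right)
  thus "nmul m (x + y) \<in> H"
    using H by (simp add: nmul_plus subgrp_add nmul_mem_iff)
qed

text \<open>An element \<open>g\<close> of largest order works: if a prime \<open>p\<close> occurred
  to a higher power in the order of some \<open>x\<close>, trading the \<open>p\<close>-part of
  \<open>g\<close> for that of \<open>x\<close> would give a larger order.\<close>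

lemma relord_exponent: "\<exists>g. \<forall>x. relord H x dvd relord H g"
proof -
  obtain g where g: "\<And>x. relord H x \<le> relord H g"
  proof -
    have "Max (range (relord H)) \<in> range (relord H)" by (intro Max_in) auto
    then obtain g where "relord H g = Max (range (relord H))" by force
    thus ?thesis by (intro that[of g]) auto
  qed
  have "relord H x dvd relord H g" for x
  proof (rule multiplicity_le_imp_dvd)
    show "relord H x \<noteq> 0" using relord_pos[of x] by simp
    fix p :: nat assume p: "prime p"
    show "multiplicity p (relord H x) \<le> multiplicity p (relord H g)"
    proof (rule ccontr)
      assume contra: "\<not> ?thesis"
      let ?u = "multiplicity p (relord H g)" and ?v = "multiplicity p (relord H x)"
      obtain s where s: "relord H g = p ^ ?u * s" "\<not> p dvd s"
        using multiplicity_decompose'[of "relord H g" p] relord_pos[of g] p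
        by (metis not_prime_unit less_not_refl)
      obtain t where t: "relord H x = p ^ ?v * t"
        using multiplicity_dvd by (metis dvdE)
      \<comment> \<open>The first summand has the order of \<open>g\<close> without its
        \<open>p\<close>-part, the second only the \<open>p\<close>-part of the order of
        \<open>x\<close>, so the two orders are coprime.\<close>
      let ?y = "nmul (p ^ ?u) g + nmul t x"
      have "relord H (nmul (p ^ ?u) g) = s" using s by (intro relord_nmul) auto
      moreover have "relord H (nmul t x) = p ^ ?v"
        using t by (intro relord_nmul) (auto simp: mult.commute)
      moreover have "coprime s (p ^ ?v)"
        using p s(2) prime_imp_coprime[of p s] by (simp add: coprime_commute)
      ultimately have "relord H ?y = s * p ^ ?v"
        using relord_add_coprime by metis
      moreover have "s > 0" using s relord_pos[of g] by (cases s) auto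
      moreover have "p ^ ?u < p ^ ?v"
        using p contra by (intro power_strict_increasing) (auto simp: prime_gt_Suc_0_nat)
      ultimately have "relord H ?y > relord H g"
        using s(1) by (metis mult.commute mult_less_mono2)
      thus False using g[of ?y] by simp
    qed
  qed
  thus ?thesis by blast
qed

end

section \<open>Spans of sequences\<close>

text \<open>Natural coefficients suffice: in a finite group this is the subgroup generated by the
  first \<open>k\<close> terms.\<close>

definition spn :: "(nat \<Rightarrow> 'a::ab_group_add) \<Rightarrow> nat \<Rightarrow> 'a set" where
  "spn b k = {\<Sum>i<k. nmul (x i) (b i) | x. True}"

text \<open>The \<open>d\<^sub>i\<close> of the opening comment, and the \<open>m\<^sub>i\<close>
  when the sequence is a basis.\<close>

abbreviation seqord :: "(nat \<Rightarrow> 'a::ab_group_add) \<Rightarrow> nat \<Rightarrow> nat" where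
  "seqord b i \<equiv> relord (spn b i) (b i)"

lemma spn_cong: "(\<And>i. i < k \<Longrightarrow> b i = c i) \<Longrightarrow> spn b k = spn c k"
  unfolding spn_def by (intro Collect_cong ex_cong1) (auto intro!: sum.cong)

lemma sum_in_spn: "(\<Sum>i<k. nmul (x i) (b i)) \<in> spn b k"
  by (auto simp: spn_def)

lemma subgrp_spn [simp]: "subgrp (spn (b :: nat \<Rightarrow> 'a::{ab_group_add,finite}) k)"
proof (rule subgrpI_finite)
  have "(\<Sum>i<k. nmul 0 (b i)) \<in> spn b k" by (rule sum_in_spn)
  thus "0 \<in> spn b k" by simp
  fix g h assume "g \<in> spn b k" "h \<in> spn b k"
  then obtain x y where "g = (\<Sum>i<k. nmul (x i) (b i))" "h = (\<Sum>i<k. nmul (y i) (b i))"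
    by (auto simp: spn_def)
  hence "g + h = (\<Sum>i<k. nmul (x i + y i) (b i))"
    by (simp add: nmul_add sum.distrib)
  thus "g + h \<in> spn b k" by (simp add: sum_in_spn)
qed

lemma spn_mem:
  assumes "i < k"
  shows "b i \<in> spn b k"
proof -
  have "(\<Sum>j<k. nmul (if j = i then 1 else 0) (b j)) = (\<Sum>j<k. if j = i then b j else 0)"
    by (intro sum.cong) auto
  also have "\<dots> = b i" using assms by simp
  finally show ?thesis by (metis sum_in_spn)
qed

lemma spn_least: "subgrp H \<Longrightarrow> (\<And>i. i < k \<Longrightarrow> b i \<in> H) \<Longrightarrow> spn b k \<subseteq> H"
proof (induction k)
  case (Suc k)
  show ?case
  proof
    fix g assume "g \<in> spn b (Suc k)"
    then obtain x where "g = (\<Sum>i<k. nmul (x i) (b i)) + nmul (x k) (b k)"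
      by (auto simp: spn_def)
    moreover have "(\<Sum>i<k. nmul (x i) (b i)) \<in> H"
      using Suc sum_in_spn by fastforce
    ultimately show "g \<in> H" using Suc.prems by (simp add: subgrp_add subgrp_nmul)
  qed
qed (auto simp: spn_def subgrp_0)

lemma spn_mono:
  "k \<le> l \<Longrightarrow> spn (b :: nat \<Rightarrow> 'a::{ab_group_add,finite}) k \<subseteq> spn b l"
  by (intro spn_least) (auto simp: spn_mem)

lemma seqord_pos [simp]: "seqord (b :: nat \<Rightarrow> 'a::{ab_group_add,finite}) i > 0"
  by (simp add: relord_pos)

text \<open>A mixed radix expansion: the last coefficient is reduced modulo its relative order, and
  the removed multiple of \<open>b k\<close>, which lies in the span of the predecessors, is carried
  into the induction hypothesis.\<close>

lemma spn_normal_form: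
  fixes b :: "nat \<Rightarrow> 'a::{ab_group_add,finite}"
  assumes "g \<in> spn b k"
  shows "\<exists>x. (\<forall>i<k. x i < seqord b i) \<and> g = (\<Sum>i<k. nmul (x i) (b i))"
  using assms
proof (induction k arbitrary: g)
  case 0
  thus ?case by (auto simp: spn_def)
next
  case (Suc k)
  let ?d = "seqord b k"
  obtain x where g: "g = (\<Sum>i<k. nmul (x i) (b i)) + nmul (x k) (b k)"
    using Suc.prems by (auto simp: spn_def)
  define h where "h = (\<Sum>i<k. nmul (x i) (b i)) + nmul (x k div ?d * ?d) (b k)"
  have "h \<in> spn b k"
    unfolding h_def by (intro subgrp_add sum_in_spn) (auto simp: nmul_mem_iff)
  then obtain y where y: "\<forall>i<k. y i < seqord b i" "h = (\<Sum>i<k. nmul (y i) (b i))"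
    using Suc.IH by blast
  have "nmul (x k) (b k) = nmul (x k div ?d * ?d) (b k) + nmul (x k mod ?d) (b k)"
    by (rule nmul_div_mod)
  hence "g = h + nmul (x k mod ?d) (b k)"
    using g by (simp add: h_def algebra_simps)
  also have "\<dots> = (\<Sum>i<Suc k. nmul ((y(k := x k mod ?d)) i) (b i))"
    by (simp add: y(2))
  finally show ?case
    using y(1) by (intro exI[of _ "y(k := x k mod ?d)"]) (auto simp: less_Suc_eq)
qed

text \<open>The arithmetic behind the fact that \<open>j\<close> times an element of order
  \<open>a\<close> has order \<open>a div gcd a j\<close>.\<close>

lemma div_gcd_dvd:
  fixes a :: nat
  assumes "a > 0" "a dvd u * j"
  shows "a div gcd a j dvd u"
proof -
  define g where "g = gcd a j"
  have "g > 0" using assms(1) by (simp add: g_def)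
  then obtain a' j' where aj: "a = a' * g" "j = j' * g" "coprime a' j'"
    using gcd_coprime_exists[of a j] unfolding g_def by auto
  have "a' * g dvd (u * j') * g" using assms(2) unfolding aj(1,2) by (simp only: mult.assoc)
  hence "a' dvd u" using \<open>g > 0\<close> aj(3) by (simp add: coprime_dvd_mult_left_iff)
  moreover have "a div g = a'" unfolding aj(1) using \<open>g > 0\<close> by simp
  ultimately show ?thesis by (simp add: g_def)
qed

text \<open>Modulo the span of the predecessors, \<open>j\<close> times \<open>b k\<close> has order
  \<open>seqord b k div gcd (seqord b k) j\<close>. Coefficients below this bound are determined by
  the sum, from the last one downwards.\<close>

lemma scaled_sum_inj:
  fixes b :: "nat \<Rightarrow> 'a::{ab_group_add,finite}"
  assumes "(\<Sum>i<k. nmul (y i * j) (b i)) = (\<Sum>i<k. nmul (z i * j) (b i))"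
    and "\<And>i. i < k \<Longrightarrow> y i < seqord b i div gcd (seqord b i) j"
    and "\<And>i. i < k \<Longrightarrow> z i < seqord b i div gcd (seqord b i) j"
  shows "\<forall>i<k. y i = z i"
  using assms
proof (induction k)
  case (Suc k)
  let ?d = "seqord b k"
  \<comment> \<open>One inequality at a time, because natural subtraction needs
    \<open>u < v\<close>; using it in both directions gives equality.\<close>
  have *: "v \<le> u"
    if eq: "g + nmul (u * j) (b k) = h + nmul (v * j) (b k)" "g \<in> spn b k" "h \<in> spn b k"
      and v: "v < ?d div gcd ?d j" for g h u v
  proof (rule ccontr)
    assume "\<not> v \<le> u"
    have "nmul (v * j - u * j) (b k) = g - h"
      using eq(1) \<open>\<not> v \<le> u\<close> by (simp add: nmul_diff_left algebra_simps)
    hence "nmul ((v - u) * j) (b k) \<in> spn b k"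
      using eq by (simp add: subgrp_diff diff_mult_distrib)
    hence "?d dvd (v - u) * j"
      by (simp add: nmul_mem_iff)
    hence "?d div gcd ?d j dvd v - u"
      by (intro div_gcd_dvd) auto
    thus False
      using v \<open>\<not> v \<le> u\<close> by (auto dest!: dvd_imp_le)
  qed
  let ?Y = "\<Sum>i<k. nmul (y i * j) (b i)" and ?Z = "\<Sum>i<k. nmul (z i * j) (b i)"
  have "z k \<le> y k"
    using Suc.prems by (intro *[of ?Y "y k" ?Z "z k"] sum_in_spn) auto
  moreover have "y k \<le> z k"
    using Suc.prems by (intro *[of ?Z "z k" ?Y "y k"] sum_in_spn) auto
  ultimately have eq: "y k = z k" by simp
  hence "\<forall>i<k. y i = z i"
    using Suc.prems by (intro Suc.IH) auto
  thus ?case using eq by (auto simp: less_Suc_eq)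
qed auto

lemma sum_nmul_inj:
  fixes b :: "nat \<Rightarrow> 'a::{ab_group_add,finite}"
  assumes "(\<Sum>i<k. nmul (y i) (b i)) = (\<Sum>i<k. nmul (z i) (b i))"
    and "\<And>i. i < k \<Longrightarrow> y i < seqord b i" and "\<And>i. i < k \<Longrightarrow> z i < seqord b i"
  shows "\<forall>i<k. y i = z i"
  using scaled_sum_inj[where j = 1 and k = k and y = y and z = z and b = b] assms by simp

text \<open>Distinct coefficient vectors within these bounds give distinct multiples by
  \<open>j\<close>, for every sequence, generating or not.\<close>

lemma prod_seqord_le_card_range:
  fixes b :: "nat \<Rightarrow> 'a::{ab_group_add,finite}"
  shows "(\<Prod>i<k. seqord b i div gcd (seqord b i) j) \<le> card (range (nmul j :: 'a \<Rightarrow> 'a))"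
proof -
  let ?P = "PiE {..<k} (\<lambda>i. {..<seqord b i div gcd (seqord b i) j})"
  let ?f = "\<lambda>y. \<Sum>i<k. nmul (y i * j) (b i)"
  have "inj_on ?f ?P"
  proof (rule inj_onI)
    fix y z assume yz: "y \<in> ?P" "z \<in> ?P" "?f y = ?f z"
    hence "\<forall>i<k. y i = z i"
      by (intro scaled_sum_inj) auto
    thus "y = z" using yz by (intro PiE_ext) auto
  qed
  moreover have "?f ` ?P \<subseteq> range (nmul j)"
  proof clarify
    fix y
    have "?f y = nmul j (\<Sum>i<k. nmul (y i) (b i))"
      by (simp add: nmul_sum nmul_nmul mult.commute)
    thus "?f y \<in> range (nmul j)" by simp
  qed
  ultimately have "card ?P \<le> card (range (nmul j :: 'a \<Rightarrow> 'a))"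
    by (intro card_inj_on_le) auto
  thus ?thesis by (simp add: card_PiE)
qed

lemma prod_seqord_le_card:
  fixes b :: "nat \<Rightarrow> 'a::{ab_group_add,finite}"
  shows "(\<Prod>i<k. seqord b i) \<le> card (UNIV :: 'a set)"
proof -
  have "(\<Prod>i<k. seqord b i) \<le> card (range (nmul 1 :: 'a \<Rightarrow> 'a))"
    using prod_seqord_le_card_range[where k = k and b = b and j = 1] by simp
  also have "\<dots> \<le> card (UNIV :: 'a set)" by (intro card_mono) auto
  finally show ?thesis .
qed

text \<open>Normal forms cover the group, so for a generating sequence the product of the relative
  orders is exactly the group order.\<close>

lemma card_le_prod_seqord:
  fixes b :: "nat \<Rightarrow> 'a::{ab_group_add,finite}"
  assumes "spn b k = UNIV"
  shows "card (UNIV :: 'a set) \<le> (\<Prod>i<k. seqord b i)"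
proof -
  let ?P = "PiE {..<k} (\<lambda>i. {..<seqord b i})"
  have "UNIV \<subseteq> (\<lambda>y. \<Sum>i<k. nmul (y i) (b i)) ` ?P"
  proof
    fix g
    obtain x where "\<forall>i<k. x i < seqord b i" "g = (\<Sum>i<k. nmul (x i) (b i))"
      using spn_normal_form[of g b k] assms by auto
    thus "g \<in> (\<lambda>y. \<Sum>i<k. nmul (y i) (b i)) ` ?P"
      by (intro image_eqI[of _ _ "restrict x {..<k}"]) auto
  qed
  hence "card (UNIV :: 'a set) \<le> card ?P"
    by (intro surj_card_le finite_PiE) auto
  thus ?thesis by (simp add: card_PiE)
qed

section \<open>Bases with invariant factors\<close>

text \<open>The first condition makes the sum of the cyclic groups direct. The second says that each
  order kills the quotient by the earlier terms, so each order divides the previous one. Zero terms,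
  of order 1, may pad the basis to any length.\<close>

definition inv_basis :: "(nat \<Rightarrow> 'a::ab_group_add) \<Rightarrow> nat \<Rightarrow> bool" where
  "inv_basis e N \<longleftrightarrow>
     (\<forall>i<N. nmul (seqord e i) (e i) = 0 \<and> (\<forall>g. nmul (seqord e i) g \<in> spn e i))"

lemma inv_basis_nmul_eq_0:
  assumes "inv_basis e N" "i < N" "seqord e i dvd m"
  shows "nmul m (e i) = 0"
proof -
  obtain q where "m = q * seqord e i" using assms(3) by (metis dvdE mult.commute)
  hence "nmul m (e i) = nmul q (nmul (seqord e i) (e i))" by (simp only: nmul_nmul)
  thus ?thesis using assms by (simp add: inv_basis_def)
qed

lemma inv_basis_nmul_mod:
  assumes "inv_basis e N" "i < N" "seqord e i dvd k"
  shows "nmul (x mod k) (e i) = nmul x (e i)"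
proof -
  have "nmul x (e i) = nmul (x div k * k) (e i) + nmul (x mod k) (e i)"
    by (rule nmul_div_mod)
  thus ?thesis
    using inv_basis_nmul_eq_0[OF assms(1,2), of "x div k * k"] assms(3) by simp
qed

lemma inv_basis_dvd:
  fixes e :: "nat \<Rightarrow> 'a::{ab_group_add,finite}"
  assumes "inv_basis e N" "i \<le> j" "j < N"
  shows "seqord e j dvd seqord e i"
proof -
  have "nmul (seqord e i) (e j) \<in> spn e j"
    using assms spn_mono[of i j e] by (auto simp: inv_basis_def)
  thus ?thesis by (simp add: nmul_mem_iff)
qed

lemma inv_basis_coeff_dvd:
  fixes e :: "nat \<Rightarrow> 'a::{ab_group_add,finite}"
  assumes "inv_basis e N" "n \<le> N" "(\<Sum>l<n. nmul (c l) (e l)) \<in> spn e i" "i \<le> l" "l < n"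
  shows "seqord e l dvd c l"
  using assms(2-)
proof (induction n)
  case (Suc n)
  have "spn e i \<subseteq> spn e n" using Suc.prems by (intro spn_mono) auto
  hence "(\<Sum>l<n. nmul (c l) (e l)) + nmul (c n) (e n) \<in> spn e n"
    using Suc.prems by auto
  hence "nmul (c n) (e n) \<in> spn e n"
    using subgrp_add_cancel_left[OF subgrp_spn sum_in_spn] by metis
  hence dvd: "seqord e n dvd c n" by (simp add: nmul_mem_iff)
  hence "nmul (c n) (e n) = 0"
    using assms(1) Suc.prems by (intro inv_basis_nmul_eq_0) auto
  thus ?case using Suc dvd by (cases "l = n") auto
qed auto

text \<open>The next term is an element \<open>g\<close> whose order \<open>d\<close> modulo the
  span is the exponent of the quotient, corrected by some \<open>s\<close> in the span so that
  \<open>d\<close> kills it outright.\<close>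

lemma inv_basis_exists: "\<exists>e :: nat \<Rightarrow> 'a::{ab_group_add,finite}. inv_basis e N"
proof (induction N)
  case 0
  show ?case by (auto simp: inv_basis_def)
next
  case (Suc N)
  then obtain e :: "nat \<Rightarrow> 'a" where e: "inv_basis e N" by blast
  let ?H = "spn e N"
  obtain g where g: "\<And>x. relord ?H x dvd relord ?H g"
    using relord_exponent[OF subgrp_spn] by blast
  define d where "d = relord ?H g"
  have "d > 0" by (simp add: d_def relord_pos)
  have "nmul d g \<in> ?H" by (simp add: d_def nmul_relord)
  then obtain x where x: "nmul d g = (\<Sum>i<N. nmul (x i) (e i))"
    by (auto simp: spn_def)
  \<comment> \<open>The order of \<open>e i\<close> kills the quotient by \<open>spn e i\<close>, so
    it is a multiple \<open>q * d\<close>. Then \<open>q\<close> times the expansion of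
    \<open>nmul d g\<close> lies in \<open>spn e i\<close>, which makes \<open>q * x i\<close>
    divisible by \<open>q * d\<close>.\<close>
  have dvd: "d dvd x i" if i: "i < N" for i
  proof -
    have mem: "nmul (seqord e i) g \<in> spn e i"
      using e i by (auto simp: inv_basis_def)
    hence "nmul (seqord e i) g \<in> ?H"
      using spn_mono[of i N e] i by auto
    hence "d dvd seqord e i" by (simp add: d_def nmul_mem_iff)
    then obtain q where q: "seqord e i = q * d" by (metis dvdE mult.commute)
    hence "q > 0" using seqord_pos[of e i] by (cases q) auto
    have "nmul (seqord e i) g = (\<Sum>l<N. nmul (q * x l) (e l))"
      unfolding q nmul_nmul[symmetric] x nmul_sum ..
    hence "seqord e i dvd q * x i"
      using inv_basis_coeff_dvd[OF e, of N "\<lambda>l. q * x l" i i] mem i by auto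
    thus ?thesis using q \<open>q > 0\<close> by auto
  qed
  \<comment> \<open>Dividing the coefficients by \<open>d\<close> gives a span element with the same
    \<open>d\<close>-fold multiple as \<open>g\<close>.\<close>
  define s where "s = (\<Sum>i<N. nmul (x i div d) (e i))"
  have s: "s \<in> ?H" by (simp add: s_def sum_in_spn)
  have "nmul d s = (\<Sum>i<N. nmul (x i) (e i))"
    unfolding s_def by (simp add: nmul_sum nmul_nmul dvd)
  hence 0: "nmul d (g - s) = 0" by (simp add: nmul_diff x)
  have ord: "relord ?H (g - s) = d"
  proof (rule relord_eqI)
    fix m
    have "nmul m (g - s) \<in> ?H \<longleftrightarrow> nmul m (g - s) + nmul m s \<in> ?H"
      using s by (simp add: subgrp_add_cancel_right subgrp_nmul)
    thus "nmul m (g - s) \<in> ?H \<longleftrightarrow> d dvd m"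
      by (simp add: nmul_diff d_def nmul_mem_iff)
  qed auto
  define f where "f = e(N := g - s)"
  have spn: "spn f i = spn e i" if "i \<le> N" for i
    using that by (intro spn_cong) (auto simp: f_def)
  have "nmul (seqord f i) (f i) = 0 \<and> (\<forall>g. nmul (seqord f i) g \<in> spn f i)" if "i < Suc N" for i
  proof (cases "i = N")
    case True
    have "nmul d u \<in> ?H" for u using g[of u] by (simp add: d_def nmul_mem_iff)
    thus ?thesis using True spn[of N] ord 0 by (simp add: f_def)
  next
    case False
    thus ?thesis using that spn[of i] e by (auto simp: f_def inv_basis_def)
  qed
  thus ?case unfolding inv_basis_def by blast
qed

text \<open>If all \<open>N\<close> orders were at least 2, their product would be at least
  \<open>2 ^ N\<close> and exceed the group order. An order 1 at index \<open>i\<close> means that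
  the quotient by \<open>spn e i\<close> is trivial.\<close>

lemma inv_basis_spn:
  fixes e :: "nat \<Rightarrow> 'a::{ab_group_add,finite}"
  assumes "inv_basis e N" "card (UNIV :: 'a set) \<le> N"
  shows "spn e N = UNIV"
proof -
  have "\<exists>i<N. seqord e i = 1"
  proof (rule ccontr)
    assume "\<not> ?thesis"
    hence "2 \<le> seqord e i" if "i < N" for i
      using seqord_pos[of e i] that by (metis One_nat_def Suc_leI less_one nat_neq_iff numeral_2_eq_2)
    hence "(\<Prod>i<N. 2) \<le> (\<Prod>i<N. seqord e i)" by (intro prod_mono) auto
    also have "\<dots> \<le> card (UNIV :: 'a set)" by (rule prod_seqord_le_card)
    finally have "2 ^ N \<le> N" using assms(2) by simp
    thus False using less_exp[of N] by simp
  qed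
  then obtain i where i: "i < N" "seqord e i = 1" by blast
  hence "g \<in> spn e i" for g
    using assms(1) unfolding inv_basis_def by (metis One_nat_def nmul_1)
  thus ?thesis using spn_mono[of i N e] i by auto
qed

text \<open>Compare the size of \<open>m\<^sub>k G\<close> as seen by the basis and by the sequence \<open>b\<close>.\<close>

lemma prod_seqord_dominated:
  fixes b e :: "nat \<Rightarrow> 'a::{ab_group_add,finite}"
  assumes e: "inv_basis e N" "spn e N = UNIV" and I: "I \<subseteq> {..<n}" "card I < N"
  shows "(\<Prod>i\<in>I. seqord b i) \<le> (\<Prod>i<card I. seqord e i)"
proof -
  let ?k = "card I"
  \<comment> \<open>Indices start at 0, so this is the largest order after the first
    \<open>?k\<close>. Multiplication by \<open>j\<close> kills all later basis elements and divides
    each earlier order by \<open>j\<close>.\<close>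
  define j where "j = seqord e ?k"
  have "j > 0" by (simp add: j_def)
  let ?P = "PiE {..<?k} (\<lambda>i. {..<seqord e i div j})"
  let ?f = "\<lambda>y. \<Sum>i<?k. nmul (y i * j) (e i)"
  have dvd: "j dvd seqord e i" if "i < ?k" for i
    using inv_basis_dvd[OF e(1), of i ?k] that I by (simp add: j_def)
  have "range (nmul j) \<subseteq> ?f ` ?P"
  proof clarify
    fix g :: 'a
    obtain x where "g = (\<Sum>i<N. nmul (x i) (e i))"
      using e(2) by (auto simp: spn_def set_eq_iff)
    hence "nmul j g = (\<Sum>i<N. nmul (x i * j) (e i))"
      by (simp add: nmul_sum nmul_nmul mult.commute)
    also have "\<dots> = (\<Sum>i<?k. nmul (x i * j) (e i))"
    proof (rule sum.mono_neutral_right)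
      show "\<forall>i\<in>{..<N} - {..<?k}. nmul (x i * j) (e i) = 0"
        using inv_basis_dvd[OF e(1), of ?k] by (auto simp: j_def intro!: inv_basis_nmul_eq_0[OF e(1)])
    qed (use I in auto)
    also have "\<dots> = (\<Sum>i<?k. nmul ((x i mod (seqord e i div j)) * j) (e i))"
    proof (intro sum.cong refl)
      fix i assume i: "i \<in> {..<?k}"
      have "(x i mod (seqord e i div j)) * j = (x i * j) mod seqord e i"
        using dvd[of i] i by (simp add: mult_mod_left)
      thus "nmul (x i * j) (e i) = nmul ((x i mod (seqord e i div j)) * j) (e i)"
        using inv_basis_nmul_mod[OF e(1), of i "seqord e i" "x i * j"] i I by simp
    qed
    also have "\<dots> = ?f (restrict (\<lambda>i. x i mod (seqord e i div j)) {..<?k})"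
      by (intro sum.cong) auto
    finally have eq: "nmul j g = ?f (restrict (\<lambda>i. x i mod (seqord e i div j)) {..<?k})" .
    show "nmul j g \<in> ?f ` ?P"
    proof (rule image_eqI, rule eq)
      have "0 < seqord e i div j" if "i < ?k" for i
        using dvd[OF that] \<open>j > 0\<close> seqord_pos[of e i] by (simp add: dvd_imp_le div_greater_zero_iff)
      thus "restrict (\<lambda>i. x i mod (seqord e i div j)) {..<?k} \<in> ?P" by auto
    qed
  qed
  hence "card (range (nmul j :: 'a \<Rightarrow> 'a)) \<le> card ?P"
    by (intro surj_card_le finite_PiE) auto
  hence upper: "card (range (nmul j :: 'a \<Rightarrow> 'a)) \<le> (\<Prod>i<?k. seqord e i div j)"
    by (simp add: card_PiE)
  let ?q = "\<lambda>i. seqord b i div gcd (seqord b i) j"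
  have q: "?q i \<ge> 1" for i
    using seqord_pos[of b i] by (simp add: Suc_le_eq div_greater_zero_iff dvd_imp_le)
  \<comment> \<open>Passing to multiples by \<open>j\<close> costs each order of \<open>b\<close> a
    factor of at most \<open>j\<close>, but each basis order exactly \<open>j\<close>; with
    \<open>?k\<close> factors on both sides the powers of \<open>j\<close> balance.\<close>
  have "(\<Prod>i\<in>I. seqord b i) \<le> (\<Prod>i\<in>I. ?q i * j)"
  proof (intro prod_mono conjI)
    fix i
    have "seqord b i = ?q i * gcd (seqord b i) j" by simp
    also have "\<dots> \<le> ?q i * j" using \<open>j > 0\<close> by (intro mult_le_mono2 gcd_le2_nat) auto
    finally show "seqord b i \<le> ?q i * j" .
  qed auto
  also have "\<dots> = (\<Prod>i\<in>I. ?q i) * j ^ ?k" by (simp add: prod.distrib)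
  also have "\<dots> \<le> (\<Prod>i<?k. seqord e i div j) * j ^ ?k"
  proof (rule mult_le_mono1)
    \<comment> \<open>The counting bound concerns initial segments, so \<open>I\<close> is enlarged
      to one; the added factors are at least 1.\<close>
    have "(\<Prod>i\<in>I. ?q i) \<le> (\<Prod>i<n. ?q i)"
    proof (rule dvd_imp_le)
      show "(\<Prod>i\<in>I. ?q i) dvd (\<Prod>i<n. ?q i)"
        using I by (intro prod_dvd_prod_subset) auto
      show "(\<Prod>i<n. ?q i) > 0" using q by (intro prod_pos) (metis less_le_trans zero_less_one)
    qed
    also have "\<dots> \<le> (\<Prod>i<?k. seqord e i div j)"
      using prod_seqord_le_card_range upper by (rule order_trans)
    finally show "(\<Prod>i\<in>I. ?q i) \<le> (\<Prod>i<?k. seqord e i div j)" .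
  qed
  also have "\<dots> = (\<Prod>i<?k. (seqord e i div j) * j)" by (simp add: prod.distrib)
  also have "\<dots> = (\<Prod>i<?k. seqord e i)" using dvd by (intro prod.cong) auto
  finally show ?thesis by simp
qed

section \<open>Comparing sums of relative orders\<close>

text \<open>Since \<open>d\<close> decreases, Abel summation turns the product bounds into
  \<open>\<Sum> d\<^sub>i ln (m\<^sub>i / d\<^sub>i) \<ge> 0\<close>, while \<open>d ln (m / d) \<le> m - d\<close>.\<close>

lemma sum_le_if_prods_le:
  fixes d m :: "nat \<Rightarrow> nat"
  assumes d: "\<And>i. i < n \<Longrightarrow> d i > 0" and m: "\<And>i. i < n \<Longrightarrow> m i > 0"
    and anti: "\<And>i j. i \<le> j \<Longrightarrow> j < n \<Longrightarrow> d j \<le> d i"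
    and dom: "\<And>k. k \<le> n \<Longrightarrow> (\<Prod>i<k. d i) \<le> (\<Prod>i<k. m i)"
  shows "(\<Sum>i<n. d i) \<le> (\<Sum>i<n. m i)" (is ?le)
    and "i < n \<Longrightarrow> d i \<noteq> m i \<Longrightarrow> (\<Sum>i<n. d i) < (\<Sum>i<n. m i)" (is "_ \<Longrightarrow> _ \<Longrightarrow> ?less")
proof -
  define t where "t i = ln (real (m i)) - ln (real (d i))" for i
  have S: "0 \<le> (\<Sum>i<k. t i)" if "k \<le> n" for k
  proof -
    have "(\<Sum>i<k. t i) = ln (\<Prod>i<k. real (m i)) - ln (\<Prod>i<k. real (d i))"
      using that d m by (subst (1 2) ln_prod) (auto simp: t_def sum_subtractf)
    moreover have "(\<Prod>i<k. real (d i)) \<le> (\<Prod>i<k. real (m i))"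
      using dom[OF that] by (simp flip: of_nat_prod)
    moreover have "0 < (\<Prod>i<k. real (d i))" using that d by (intro prod_pos) auto
    ultimately show ?thesis by simp
  qed
  have abel: "real (d k) * (\<Sum>i<Suc k. t i) \<le> (\<Sum>i<Suc k. d i * t i)" if "k < n" for k
    using that
  proof (induction k)
    case (Suc k)
    have "real (d (Suc k)) * (\<Sum>i<Suc k. t i) \<le> real (d k) * (\<Sum>i<Suc k. t i)"
      using Suc.prems S[of "Suc k"] anti[of k "Suc k"] by (intro mult_right_mono) auto
    thus ?case using Suc by (simp add: algebra_simps)
  qed simp
  have nonneg: "0 \<le> (\<Sum>i<n. d i * t i)"
  proof (cases n)
    case (Suc k)
    have "0 \<le> real (d k) * (\<Sum>i<Suc k. t i)" using S[of n] Suc by simp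
    thus ?thesis using abel[of k] Suc by simp
  qed simp
  have le: "real (d i) * t i \<le> real (m i) - real (d i)" if "i < n" for i
  proof -
    have "t i \<le> real (m i) / real (d i) - 1"
      using ln_le_minus_one[of "real (m i) / real (d i)"] d[OF that] m[OF that]
      by (simp add: t_def ln_div)
    thus ?thesis using d[OF that] by (simp add: field_simps)
  qed
  \<comment> \<open>Strictness comes from \<open>ln x = x - 1\<close> holding only at
    \<open>x = 1\<close>.\<close>
  have less: "real (d i) * t i < real (m i) - real (d i)" if "i < n" "d i \<noteq> m i" for i
  proof -
    have "t i \<noteq> real (m i) / real (d i) - 1"
      using ln_eq_minus_one[of "real (m i) / real (d i)"] d[OF that(1)] m[OF that(1)] that(2)
      by (auto simp: t_def ln_div)
    thus ?thesis using d[OF that(1)] le[OF that(1)] by (auto simp: field_simps)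
  qed
  have "(\<Sum>i<n. real (d i) * t i) \<le> (\<Sum>i<n. real (m i) - real (d i))"
    using le by (intro sum_mono) auto
  hence "real (\<Sum>i<n. d i) \<le> real (\<Sum>i<n. m i)"
    using nonneg by (simp add: sum_subtractf)
  thus ?le by linarith
  assume i: "i < n" "d i \<noteq> m i"
  have "(\<Sum>i<n. real (d i) * t i) < (\<Sum>i<n. real (m i) - real (d i))"
    using le less i by (intro sum_strict_mono_ex1) auto
  hence "real (\<Sum>i<n. d i) < real (\<Sum>i<n. m i)"
    using nonneg by (simp add: sum_subtractf)
  thus ?less by linarith
qed

text \<open>After sorting the orders of \<open>b\<close> decreasingly, their prefix products are
  products over index sets of size \<open>k\<close>, which the basis dominates for every
  \<open>k\<close>.\<close>

lemma sum_seqord_le: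
  fixes b e :: "nat \<Rightarrow> 'a::{ab_group_add,finite}"
  assumes e: "inv_basis e N" "spn e N = UNIV" and n: "n < N"
  shows "(\<Sum>i<n. seqord b i) \<le> (\<Sum>i<n. seqord e i)" (is ?le)
    and "(\<And>i. i < n \<Longrightarrow> seqord b i \<ge> 2) \<Longrightarrow> k < n \<Longrightarrow> seqord e k = 1 \<Longrightarrow>
      (\<Sum>i<n. seqord b i) < (\<Sum>i<n. seqord e i)" (is "PROP ?A \<Longrightarrow> _ \<Longrightarrow> _ \<Longrightarrow> ?less")
proof -
  define ys where "ys = rev (sort_key (seqord b) [0..<n])"
  define d where "d i = seqord b (ys ! i)" for i
  have ys: "distinct ys" "length ys = n" "set ys = {..<n}"
    by (auto simp: ys_def)
  have sorted: "sorted (rev (map (seqord b) ys))"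
    by (simp add: ys_def rev_map)
  have anti: "d j \<le> d i" if "i \<le> j" "j < n" for i j
    using sorted_rev_nth_mono[OF sorted, of i j] that ys by (simp add: d_def)
  have dom: "(\<Prod>i<k. d i) \<le> (\<Prod>i<k. seqord e i)" if "k \<le> n" for k
  proof -
    have inj: "inj_on ((!) ys) {..<k}"
      using ys that by (auto simp: inj_on_def nth_eq_iff_index_eq)
    have "(!) ys ` {..<k} \<subseteq> set ys"
      using that ys(2) by (intro image_subsetI nth_mem) simp
    moreover have "card ((!) ys ` {..<k}) = k" using inj by (simp add: card_image)
    ultimately have "(\<Prod>i\<in>(!) ys ` {..<k}. seqord b i) \<le> (\<Prod>i<k. seqord e i)"
      using prod_seqord_dominated[OF e, of "(!) ys ` {..<k}" n b] ys that n by simp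
    thus ?thesis using inj by (simp add: prod.reindex d_def)
  qed
  have "bij_betw ((!) ys) {..<n} {..<n}" using ys by (intro bij_betw_nth) auto
  hence sum: "(\<Sum>i<n. seqord b i) = (\<Sum>i<n. d i)"
    unfolding d_def by (rule sum.reindex_bij_betw[symmetric])
  show ?le
    unfolding sum using anti dom by (intro sum_le_if_prods_le) (auto simp: d_def)
  assume b: "PROP ?A" and k: "k < n" "seqord e k = 1"
  have "ys ! k \<in> set ys" using ys(2) k(1) by (intro nth_mem) simp
  hence "ys ! k < n" using ys(3) by simp
  \<comment> \<open>At \<open>k\<close> the basis has order 1 while all orders of \<open>b\<close>
    are at least 2, so the two sequences differ there.\<close>
  hence "d k \<noteq> seqord e k" using b[of "ys ! k"] k by (simp add: d_def)
  thus ?less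
    unfolding sum using anti dom k(1)
    by (intro sum_le_if_prods_le(2)[where i = k]) (auto simp: d_def)
qed

section \<open>Sumsets and diameters\<close>

lemma zero_in_sumset: "(0 :: 'a::comm_monoid_add) \<in> sumset A k"
proof -
  have "sum_list (replicate k (0 :: 'a)) = 0" by (induction k) auto
  thus ?thesis unfolding sumset_def by (auto intro!: exI[of _ "replicate k 0"])
qed

lemma sumset_0: "sumset A 0 = {0}"
  by (auto simp: sumset_def)

lemma sumset_1: "sumset A 1 = insert 0 A"
  by (auto simp: sumset_def length_Suc_conv intro!: exI[of _ "[_]"])

lemma sumset_add:
  assumes "x \<in> sumset A k" "y \<in> sumset A l"
  shows "x + y \<in> sumset A (k + l)"
proof -
  obtain xs ys where "x = sum_list xs" "length xs = k" "set xs \<subseteq> insert 0 A"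
    and "y = sum_list ys" "length ys = l" "set ys \<subseteq> insert 0 A"
    using assms unfolding sumset_def by blast
  thus ?thesis unfolding sumset_def by (intro CollectI exI[of _ "xs @ ys"]) simp
qed

lemma sumset_2: "x \<in> sumset A 2 \<longleftrightarrow> (\<exists>u\<in>insert 0 A. \<exists>v\<in>insert 0 A. x = u + v)"
proof
  assume "x \<in> sumset A 2"
  then obtain xs where xs: "x = sum_list xs" "length xs = Suc (Suc 0)" "set xs \<subseteq> insert 0 A"
    by (auto simp: sumset_def)
  then obtain u v where "xs = [u, v]" by (auto simp: length_Suc_conv)
  thus "\<exists>u\<in>insert 0 A. \<exists>v\<in>insert 0 A. x = u + v"
    using xs by auto
next
  assume "\<exists>u\<in>insert 0 A. \<exists>v\<in>insert 0 A. x = u + v"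
  then obtain u v where "u \<in> insert 0 A" "v \<in> insert 0 A" "x = u + v" by blast
  thus "x \<in> sumset A 2"
    using sumset_add[of u A 1 v 1] unfolding sumset_1 one_add_one by blast
qed

lemma sumset_mono:
  assumes "k \<le> l" "A \<subseteq> B"
  shows "sumset A k \<subseteq> sumset B l"
proof
  fix x assume "x \<in> sumset A k"
  hence "x \<in> sumset B k" using assms(2) by (auto simp: sumset_def)
  thus "x \<in> sumset B l" using sumset_add[of x B k 0 "l - k"] zero_in_sumset[of B "l - k"] assms(1) by simp
qed

lemma sumset_insert_0: "sumset (insert 0 A) k = sumset A k"
  by (simp add: sumset_def)

lemma nmul_in_sumset: "a \<in> insert 0 A \<Longrightarrow> nmul k a \<in> sumset A k"
proof (induction k)
  case (Suc k)
  thus ?case using sumset_add[of a A 1 "nmul k a" k] unfolding sumset_1 by simp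
qed (simp add: sumset_0)

lemma sum_nmul_in_sumset:
  fixes a :: "nat \<Rightarrow> 'a::ab_group_add"
  assumes "\<And>i. i < n \<Longrightarrow> a i \<in> insert 0 A" "(\<Sum>i<n. x i) \<le> L"
  shows "(\<Sum>i<n. nmul (x i) (a i)) \<in> sumset A L"
proof -
  have "(\<Sum>i<m. nmul (x i) (a i)) \<in> sumset A (\<Sum>i<m. x i)" if "m \<le> n" for m
    using that
  proof (induction m)
    case (Suc m)
    thus ?case using assms(1)[of m] by (simp add: sumset_add nmul_in_sumset)
  qed (simp add: sumset_0)
  thus ?thesis using sumset_mono[OF assms(2) order_refl] by blast
qed

text \<open>Each nonzero entry is charged to one index; zero entries are not charged, hence the
  inequality.\<close>

lemma sum_list_eq_sum_nmul:
  fixes a :: "nat \<Rightarrow> 'a::ab_group_add"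
  assumes "set xs \<subseteq> insert 0 (a ` {..<n})"
  shows "\<exists>c. sum_list xs = (\<Sum>i<n. nmul (c i) (a i)) \<and> (\<Sum>i<n. c i) \<le> length xs"
  using assms
proof (induction xs)
  case Nil
  show ?case by (intro exI[of _ "\<lambda>_. 0"]) auto
next
  case (Cons x xs)
  then obtain c where c: "sum_list xs = (\<Sum>i<n. nmul (c i) (a i))" "(\<Sum>i<n. c i) \<le> length xs"
    by auto
  show ?case
  proof (cases "x = 0")
    case True
    thus ?thesis using c by (intro exI[of _ c]) auto
  next
    case False
    then obtain j where j: "j < n" "x = a j" using Cons.prems by auto
    define c' where "c' i = (if i = j then 1 else 0) + c i" for i
    have "(\<Sum>i<n. nmul (c' i) (a i)) = (\<Sum>i<n. (if i = j then a i else 0) + nmul (c i) (a i))"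
      by (intro sum.cong) (auto simp: c'_def)
    also have "\<dots> = x + sum_list xs" using j c(1) by (simp add: sum.distrib)
    finally have "sum_list (x # xs) = (\<Sum>i<n. nmul (c' i) (a i))" by simp
    moreover have "(\<Sum>i<n. c' i) \<le> length (x # xs)"
      using j c(2) by (simp add: c'_def sum.distrib)
    ultimately show ?thesis by blast
  qed
qed

section \<open>Diameter, generation and rank\<close>

lemma diamA_le:
  assumes "sumset A k = UNIV"
  shows "diamA A \<le> enat k"
proof -
  have "diamA A = enat (LEAST \<rho>. sumset A \<rho> = UNIV)"
    unfolding diamA_def using assms by (intro if_P exI)
  moreover have "(LEAST \<rho>. sumset A \<rho> = UNIV) \<le> k" using assms by (rule Least_le)
  ultimately show ?thesis by simp
qed

text \<open>Sumsets grow with their length, so failure at \<open>k\<close> means failure at all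
  smaller lengths. An infinite diameter is covered, and the successor avoids a truncated
  \<open>\<rho> - 1\<close>.\<close>

lemma le_diamA_iff: "enat (Suc k) \<le> diamA A \<longleftrightarrow> sumset A k \<noteq> UNIV"
proof
  show "enat (Suc k) \<le> diamA A \<Longrightarrow> sumset A k \<noteq> UNIV"
    using diamA_le[of A k] by (metis Suc_n_not_le_n enat_ord_simps(1) order_trans)
  assume k: "sumset A k \<noteq> UNIV"
  have "Suc k \<le> (LEAST \<rho>. sumset A \<rho> = UNIV)" if "sumset A \<rho> = UNIV" for \<rho>
  proof (rule ccontr)
    assume "\<not> ?thesis"
    moreover have "sumset A (LEAST \<rho>. sumset A \<rho> = UNIV) = UNIV"
      using that by (rule LeastI)
    ultimately show False
      using k sumset_mono[of "LEAST \<rho>. sumset A \<rho> = UNIV" k A A] by auto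
  qed
  thus "enat (Suc k) \<le> diamA A" by (auto simp: diamA_def)
qed

lemma subgrp_sumset: "subgrp H \<Longrightarrow> A \<subseteq> H \<Longrightarrow> sumset A k \<subseteq> H"
proof -
  assume H: "subgrp H" "A \<subseteq> H"
  have "sum_list xs \<in> H" if "set xs \<subseteq> insert 0 A" for xs
    using that H by (induction xs) (auto simp: subgrp_0 subgrp_add subset_iff)
  thus ?thesis by (auto simp: sumset_def)
qed

text \<open>The union of all sumsets is closed under addition, hence a subgroup; by finiteness one
  length serves all elements.\<close>

lemma generates_iff_sumset:
  fixes A :: "'a::{ab_group_add,finite} set"
  shows "generates A \<longleftrightarrow> (\<exists>k. sumset A k = UNIV)"
proof
  assume "\<exists>k. sumset A k = UNIV"
  thus "generates A"
    unfolding generates_iff using subgrp_sumset by blast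
next
  assume A: "generates A"
  have "subgrp (\<Union>k. sumset A k)"
  proof (rule subgrpI_finite)
    show "0 \<in> (\<Union>k. sumset A k)" using zero_in_sumset[of A 0] by blast
    fix x y assume "x \<in> (\<Union>k. sumset A k)" "y \<in> (\<Union>k. sumset A k)"
    then obtain k l where "x \<in> sumset A k" "y \<in> sumset A l" by blast
    hence "x + y \<in> sumset A (k + l)" by (rule sumset_add)
    thus "x + y \<in> (\<Union>k. sumset A k)" by blast
  qed
  moreover have "A \<subseteq> (\<Union>k. sumset A k)"
    using sumset_1[of A] by blast
  ultimately have "(\<Union>k. sumset A k) = UNIV" using A generates_iff by blast
  hence "\<forall>g. \<exists>k. g \<in> sumset A k" by blast
  then obtain f where f: "\<And>g. g \<in> sumset A (f g)" by metis
  have "g \<in> sumset A (Max (range f))" for g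
    using f[of g] sumset_mono[of "f g" "Max (range f)" A A] by auto
  thus "\<exists>k. sumset A k = UNIV" by blast
qed

text \<open>Identifies the finiteness condition in \<open>s_rho\<close> with the generation
  condition in \<open>t_rho\<close>.\<close>

lemma generates_iff_diamA:
  "generates (A :: 'a::{ab_group_add,finite} set) \<longleftrightarrow> diamA A < \<infinity>"
  by (auto simp: generates_iff_sumset diamA_def)

lemma generates_mono: "generates A \<Longrightarrow> A \<subseteq> B \<Longrightarrow> generates B"
  unfolding generates_iff by blast

lemma generates_remove_0: "generates A \<Longrightarrow> generates (A - {0})"
  unfolding generates_iff using subgrp_0 by blast

lemma generates_UNIV: "generates UNIV"
  unfolding generates_iff by blast

lemma generates_image_iff:
  "generates ((a :: nat \<Rightarrow> 'a::{ab_group_add,finite}) ` {..<n}) \<longleftrightarrow> spn a n = UNIV"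
proof
  assume "generates (a ` {..<n})"
  moreover have "a ` {..<n} \<subseteq> spn a n" by (auto intro: spn_mem)
  ultimately show "spn a n = UNIV" using subgrp_spn by (simp add: generates_iff)
next
  assume a: "spn a n = UNIV"
  show "generates (a ` {..<n})"
    unfolding generates_iff
  proof clarify
    fix H assume "a ` {..<n} \<subseteq> H" "subgrp H"
    hence "spn a n \<subseteq> H" by (intro spn_least) auto
    thus "H = UNIV" using a by auto
  qed
qed

lemma diam_plus_ge:
  fixes G :: "'a::{ab_group_add,finite} itself"
  shows "generates (A :: 'a set) \<Longrightarrow> diamA A \<le> diam_plus G"
  unfolding diam_plus_def by (intro Max_ge) auto

lemma diam_plus_attained:
  fixes G :: "'a::{ab_group_add,finite} itself"
  obtains A :: "'a set" where "generates A" "diamA A = diam_plus G"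
proof -
  have "diam_plus G \<in> {diamA (A::'a set) | A. generates A}"
    unfolding diam_plus_def using generates_UNIV by (intro Max_in) auto
  thus ?thesis using that by auto
qed

lemma rk_le:
  fixes G :: "'a::{ab_group_add,finite} itself"
  shows "generates (A :: 'a set) \<Longrightarrow> rk G \<le> card A"
  unfolding rk_def by (intro Least_le) auto

lemma rk_attained:
  fixes G :: "'a::{ab_group_add,finite} itself"
  obtains A :: "'a set" where "generates A" "card A = rk G"
proof -
  have "\<exists>A::'a set. card A = rk G \<and> generates A"
    unfolding rk_def by (rule LeastI_ex) (use generates_UNIV in blast)
  thus ?thesis using that by blast
qed

section \<open>Generating sets of maximal diameter\<close>

text \<open>The element with all coordinates \<open>seqord e i - 1\<close> needs the full length: in
  any representation each coefficient is congruent to this coordinate modulo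
  \<open>seqord e i\<close>, hence at least as large.\<close>

lemma inv_basis_diam_plus:
  fixes G :: "'a::{ab_group_add,finite} itself" and e :: "nat \<Rightarrow> 'a"
  assumes e: "inv_basis e N" "spn e N = UNIV"
  shows "enat (\<Sum>i<N. seqord e i - 1) \<le> diam_plus G"
proof -
  let ?L = "\<Sum>i<N. seqord e i - 1" and ?A = "e ` {..<N}"
  have "enat ?L \<le> diamA ?A"
  proof (cases ?L)
    case (Suc k)
    let ?g = "\<Sum>i<N. nmul (seqord e i - 1) (e i)"
    have "?g \<notin> sumset ?A k"
    proof
      assume "?g \<in> sumset ?A k"
      then obtain xs where xs: "?g = sum_list xs" "length xs = k" "set xs \<subseteq> insert 0 ?A"
        by (auto simp: sumset_def)
      then obtain c where c: "?g = (\<Sum>i<N. nmul (c i) (e i))" "(\<Sum>i<N. c i) \<le> k"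
        using sum_list_eq_sum_nmul[of xs e N] by auto
      have "?g = (\<Sum>i<N. nmul (c i mod seqord e i) (e i))"
        unfolding c(1) using inv_basis_nmul_mod[OF e(1)] by (intro sum.cong) auto
      hence eq: "\<forall>i<N. seqord e i - 1 = c i mod seqord e i"
        by (intro sum_nmul_inj) auto
      have "?L \<le> (\<Sum>i<N. c i)"
        using eq by (intro sum_mono) (auto intro: mod_less_eq_dividend)
      thus False using c(2) Suc by simp
    qed
    thus ?thesis using Suc by (auto simp: le_diamA_iff)
  qed (simp add: zero_enat_def[symmetric])
  also have "\<dots> \<le> diam_plus G"
    using e(2) by (intro diam_plus_ge) (simp add: generates_image_iff)
  finally show ?thesis .
qed

text \<open>The bound is the greatest possible length of a normal form.\<close>

lemma sumset_seqord:
  fixes a :: "nat \<Rightarrow> 'a::{ab_group_add,finite}"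
  assumes "spn a n = UNIV" "\<And>i. i < n \<Longrightarrow> a i \<in> A"
  shows "sumset A (\<Sum>i<n. seqord a i - 1) = UNIV"
proof -
  have "g \<in> sumset A (\<Sum>i<n. seqord a i - 1)" for g
  proof -
    obtain x where x: "\<forall>i<n. x i < seqord a i" "g = (\<Sum>i<n. nmul (x i) (a i))"
      using spn_normal_form[of g a n] assms(1) by auto
    have "(\<Sum>i<n. x i) \<le> (\<Sum>i<n. seqord a i - 1)"
      using x(1) by (intro sum_mono) fastforce
    thus ?thesis unfolding x(2) using assms(2) by (intro sum_nmul_in_sumset) auto
  qed
  thus ?thesis by blast
qed

text \<open>Only the element with all coordinates \<open>d\<^sub>i - 1\<close> can need the full length,
  and a redundant generator shortens it.\<close>

lemma sumset_redundant:
  fixes a :: "nat \<Rightarrow> 'a::{ab_group_add,finite}"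
  assumes a: "spn a n = UNIV" "\<And>i. i < n \<Longrightarrow> a i \<in> A" "inj_on a {..<n}" "0 \<notin> a ` {..<n}"
    and k: "k < n" "seqord a k = 1"
  shows "\<exists>L < (\<Sum>i<n. seqord a i - 1). sumset A L = UNIV"
proof -
  let ?D = "\<Sum>i<n. seqord a i - 1"
  have "a k \<in> spn a k"
    using nmul_mem_iff[OF subgrp_spn, of 1 "a k" a k] k(2) by simp
  then obtain z where z: "\<forall>i<k. z i < seqord a i" "a k = (\<Sum>i<k. nmul (z i) (a i))"
    using spn_normal_form by blast
  define y where "y i = (if i < k then z i else 0)" for i
  have y_le: "y i \<le> seqord a i - 1" if "i < n" for i
    using z(1) by (auto simp: y_def less_eq_Suc_le[symmetric] intro: Suc_leI less_Suc_eq_le[THEN iffD1])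
  have y: "a k = (\<Sum>i<n. nmul (y i) (a i))"
  proof -
    have "(\<Sum>i<n. nmul (y i) (a i)) = (\<Sum>i<k. nmul (y i) (a i))"
      using k(1) by (intro sum.mono_neutral_right) (auto simp: y_def)
    also have "\<dots> = a k" unfolding z(2) by (intro sum.cong) (auto simp: y_def)
    finally show ?thesis by simp
  qed
  \<comment> \<open>The expansion of \<open>a k\<close> has length at least 2: length 0 would make
    \<open>a k\<close> zero, and length 1 would make it equal to an earlier generator, against
    injectivity.\<close>
  have "(\<Sum>i<n. y i) \<noteq> 0"
  proof
    assume "(\<Sum>i<n. y i) = 0"
    hence "a k = 0" unfolding y by (intro sum.neutral) auto
    thus False using a(4) k(1) by auto
  qed
  moreover have "(\<Sum>i<n. y i) \<noteq> 1"
  proof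
    assume "(\<Sum>i<n. y i) = 1"
    hence "\<exists>j\<in>{..<n}. y j = 1 \<and> (\<forall>i\<in>{..<n}. j \<noteq> i \<longrightarrow> y i = 0)"
      using sum_eq_1_iff[of "{..<n}" y] by simp
    then obtain j where j: "j < n" "y j = 1" "\<And>i. i < n \<Longrightarrow> i \<noteq> j \<Longrightarrow> y i = 0"
      by force
    have "a k = (\<Sum>i<n. if i = j then a i else 0)"
      unfolding y using j by (intro sum.cong) auto
    also have "\<dots> = a j" using j(1) by simp
    finally have "k = j" using a(3) j(1) k(1) by (auto dest: inj_onD)
    thus False using j(2) by (simp add: y_def)
  qed
  ultimately have y2: "(\<Sum>i<n. y i) \<ge> 2" by linarith
  have yD: "(\<Sum>i<n. y i) \<le> ?D" using y_le by (intro sum_mono) auto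
  have "g \<in> sumset A (?D - 1)" for g
  proof -
    obtain x where x: "\<forall>i<n. x i < seqord a i" "g = (\<Sum>i<n. nmul (x i) (a i))"
      using spn_normal_form[of g a n] a(1) by auto
    have x_le: "x i \<le> seqord a i - 1" if "i < n" for i
      using x(1) that by fastforce
    hence "(\<Sum>i<n. x i) \<le> ?D" by (intro sum_mono) auto
    show ?thesis
    proof (cases "(\<Sum>i<n. x i) = ?D")
      case False
      thus ?thesis
        unfolding x(2) using a(2) \<open>(\<Sum>i<n. x i) \<le> ?D\<close> by (intro sum_nmul_in_sumset) auto
    next
      case True
      hence top: "x i = seqord a i - 1" if "i < n" for i
        using sum_mono_inv[of x "{..<n}" "\<lambda>i. seqord a i - 1" i] x_le that by auto
      \<comment> \<open>The top element contains the expansion of \<open>a k\<close>, because all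
        its coordinates are maximal. Replacing these two or more summands by the single
        \<open>a k\<close> saves at least one.\<close>
      have "g = (\<Sum>i<n. nmul (x i - y i) (a i) + nmul (y i) (a i))"
        unfolding x(2)
      proof (intro sum.cong refl)
        fix i assume "i \<in> {..<n}"
        hence "x i = (x i - y i) + y i" using y_le[of i] top[of i] by simp
        thus "nmul (x i) (a i) = nmul (x i - y i) (a i) + nmul (y i) (a i)"
          by (metis nmul_add)
      qed
      also have "\<dots> = (\<Sum>i<n. nmul (x i - y i) (a i)) + a k"
        unfolding sum.distrib y[symmetric] ..
      also have "\<dots> \<in> sumset A ((?D - (\<Sum>i<n. y i)) + 1)"
      proof (rule sumset_add)
        have "(\<Sum>i<n. x i - y i) = ?D - (\<Sum>i<n. y i)"
          unfolding True[symmetric] using y_le top by (intro sum_subtractf_nat) auto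
        thus "(\<Sum>i<n. nmul (x i - y i) (a i)) \<in> sumset A (?D - (\<Sum>i<n. y i))"
          using a(2) by (intro sum_nmul_in_sumset) auto
        show "a k \<in> sumset A 1" using a(2) k(1) unfolding sumset_1 by simp
      qed
      finally have "g \<in> sumset A (?D - (\<Sum>i<n. y i) + 1)" .
      moreover have "?D - (\<Sum>i<n. y i) + 1 \<le> ?D - 1" using y2 yD by linarith
      ultimately show ?thesis using sumset_mono[of _ "?D - 1" A A] by blast
    qed
  qed
  hence "sumset A (?D - 1) = UNIV" by blast
  moreover have "?D - 1 < ?D" using y2 yD by linarith
  ultimately show ?thesis by blast
qed

lemma finite_enumeration:
  assumes "finite A"
  obtains a :: "nat \<Rightarrow> 'a" where "inj_on a {..<card A}" "a ` {..<card A} = A"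
proof -
  obtain h where "bij_betw h {0..<card A} A"
    using ex_bij_betw_nat_finite[OF assms] by blast
  thus ?thesis by (intro that[of h]) (auto simp: bij_betw_def atLeast0LessThan)
qed

text \<open>A generating set of \<open>rk G\<close> elements bounds the group order by the product
  of the first \<open>rk G\<close> basis orders. Including the next order still gives at most the
  group order, so that order is 1.\<close>

lemma inv_basis_rk:
  fixes G :: "'a::{ab_group_add,finite} itself" and e :: "nat \<Rightarrow> 'a"
  assumes e: "inv_basis e N" "spn e N = UNIV" and "rk G < N"
  shows "seqord e (rk G) = 1"
proof -
  obtain A :: "'a set" where A: "generates A" "card A = rk G" using rk_attained .
  obtain b where "inj_on b {..<card A}" "b ` {..<card A} = A"
    by (rule finite_enumeration[OF finite])
  hence "spn b (rk G) = UNIV" using A generates_image_iff[of b "card A"] by simp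
  hence "card (UNIV :: 'a set) \<le> (\<Prod>i<rk G. seqord b i)" by (rule card_le_prod_seqord)
  also have "\<dots> \<le> (\<Prod>i<rk G. seqord e i)"
    using prod_seqord_dominated[OF e, of "{..<rk G}" "rk G" b] assms(3) by simp
  finally have "card (UNIV :: 'a set) \<le> (\<Prod>i<rk G. seqord e i)" .
  moreover have "(\<Prod>i<rk G. seqord e i) * seqord e (rk G) \<le> card (UNIV :: 'a set)"
    using prod_seqord_le_card[where k = "Suc (rk G)" and b = e] by simp
  ultimately have "(\<Prod>i<rk G. seqord e i) * seqord e (rk G) \<le> (\<Prod>i<rk G. seqord e i) * 1"
    by linarith
  moreover have "(\<Prod>i<rk G. seqord e i) > 0" by (intro prod_pos) auto
  ultimately have "seqord e (rk G) \<le> 1" unfolding mult_le_cancel1 by blast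
  thus ?thesis using seqord_pos[of e "rk G"] by linarith
qed

text \<open>Strictness has two sources: a relative order 1 signals a redundant generator, nonzero by
  assumption, which shortens the top element; otherwise all relative orders are at least 2 while the
  basis already has order 1 at index \<open>rk G\<close>.\<close>

lemma diamA_less_if_rk_less_card:
  fixes G :: "'a::{ab_group_add,finite} itself" and A :: "'a set"
  assumes A: "generates A" "0 \<notin> A" "rk G < card A"
  shows "diamA A < diam_plus G"
proof -
  define n where "n = card A"
  \<comment> \<open>Long enough both to exceed \<open>n\<close> and to make the basis span the
    group.\<close>
  define N where "N = n + card (UNIV :: 'a set)"
  have "card (UNIV :: 'a set) > 0" by (simp add: card_gt_0_iff)
  hence n: "n < N" by (simp add: N_def)
  obtain e :: "nat \<Rightarrow> 'a" where e: "inv_basis e N" using inv_basis_exists by blast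
  have eN: "spn e N = UNIV" using e by (rule inv_basis_spn) (simp add: N_def)
  obtain a where a: "inj_on a {..<n}" "a ` {..<n} = A"
    unfolding n_def by (rule finite_enumeration[OF finite])
  have an: "spn a n = UNIV" using a(2) A(1) by (simp flip: generates_image_iff)
  have aA: "a i \<in> A" if "i < n" for i using a(2) that by auto
  \<comment> \<open>Orders are positive, so comparing sums of \<open>seqord f i - 1\<close> amounts
    to comparing sums of orders.\<close>
  have one: "(\<Sum>i<n. seqord f i - 1) + n = (\<Sum>i<n. seqord f i)" for f :: "nat \<Rightarrow> 'a"
  proof -
    have "(\<Sum>i<n. seqord f i - 1) + (\<Sum>i<n. 1) = (\<Sum>i<n. seqord f i)"
      unfolding sum.distrib[symmetric] using seqord_pos[of f]
      by (intro sum.cong) (auto simp: Suc_le_eq)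
    thus ?thesis by simp
  qed
  have e_le: "enat (\<Sum>i<n. seqord e i - 1) \<le> diam_plus G"
  proof -
    have "(\<Sum>i<n. seqord e i - 1) \<le> (\<Sum>i<N. seqord e i - 1)"
      using n by (intro sum_mono2) auto
    thus ?thesis using inv_basis_diam_plus[OF e eN, of G] by (meson enat_ord_simps(1) order_trans)
  qed
  show ?thesis
  proof (cases "\<exists>k<n. seqord a k = 1")
    case True
    then obtain k where "k < n" "seqord a k = 1" by blast
    moreover have "0 \<notin> a ` {..<n}" using A(2) a(2) by simp
    ultimately obtain L where L: "L < (\<Sum>i<n. seqord a i - 1)" "sumset A L = UNIV"
      using sumset_redundant[OF an aA a(1)] by blast
    have "(\<Sum>i<n. seqord a i - 1) \<le> (\<Sum>i<n. seqord e i - 1)"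
      using sum_seqord_le(1)[OF e eN n, of a] one[of a] one[of e] by linarith
    hence "enat L < enat (\<Sum>i<n. seqord e i - 1)" using L(1) by simp
    thus ?thesis using diamA_le[OF L(2)] e_le by (meson order_le_less_trans order_less_le_trans)
  next
    case False
    have "seqord a i \<ge> 2" if "i < n" for i
      using False that seqord_pos[of a i] by (metis One_nat_def Suc_leI le_neq_implies_less numeral_2_eq_2)
    moreover have "rk G < n" using A(3) by (simp add: n_def)
    moreover have "seqord e (rk G) = 1" using inv_basis_rk[OF e eN, of G] n \<open>rk G < n\<close> by simp
    ultimately have "(\<Sum>i<n. seqord a i) < (\<Sum>i<n. seqord e i)"
      by (intro sum_seqord_le(2)[OF e eN n])
    hence "enat (\<Sum>i<n. seqord a i - 1) < enat (\<Sum>i<n. seqord e i - 1)"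
      using one[of a] one[of e] by simp
    moreover have "diamA A \<le> enat (\<Sum>i<n. seqord a i - 1)"
      using sumset_seqord[OF an aA] by (rule diamA_le)
    ultimately show ?thesis using e_le by (meson order_le_less_trans order_less_le_trans)
  qed
qed

section \<open>Large aperiodic generating sets\<close>

lemma aperiodicI: "(\<And>p. (\<lambda>x. x + p) ` S = S \<Longrightarrow> p = 0) \<Longrightarrow> aperiodic S"
  by (auto simp: aperiodic_def period_def)

text \<open>Supersets of a generating set generate, so one of largest size for diameter at least
  \<open>\<rho>\<close> is \<open>\<rho>\<close>-maximal. A single aperiodic example thus settles
  both quantities.\<close>

lemma t_rho_s_rho_eqI:
  fixes G :: "'a::{ab_group_add,finite} itself" and A :: "'a set"
  assumes A: "generates A" "enat \<rho> \<le> diamA A" "aperiodic A"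
    and max: "\<And>B :: 'a set. generates B \<Longrightarrow> enat \<rho> \<le> diamA B \<Longrightarrow> card B \<le> card A"
  shows "t_rho G \<rho> = card A \<and> s_rho G \<rho> = card A"
proof -
  have "\<not> enat \<rho> \<le> diamA B" if "A \<subset> B" for B
    using max[of B] generates_mono[OF A(1), of B] psubset_card_mono[OF _ that] that by auto
  hence "rho_maximal \<rho> A" using A(2) by (auto simp: rho_maximal_def)
  hence "t_rho G \<rho> = card A"
    unfolding t_rho_def
    by (intro Max_eqI) (use A max in \<open>auto simp: rho_maximal_def\<close>)
  moreover have "s_rho G \<rho> = card A"
    unfolding s_rho_def
    by (intro Max_eqI) (use A max in \<open>auto simp: generates_iff_diamA\<close>)
  ultimately show ?thesis by blast
qed

section \<open>Sets of half the group order\<close>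

lemma card_le_half:
  fixes C :: "'a::{ab_group_add,finite} set"
  assumes "\<And>u v. u \<in> C \<Longrightarrow> v \<in> C \<Longrightarrow> u + v \<noteq> g"
  shows "card C \<le> card (UNIV :: 'a set) div 2"
proof -
  \<comment> \<open>The reflection \<open>x \<mapsto> g - x\<close> moves \<open>C\<close> off
    itself.\<close>
  have "C \<inter> (\<lambda>x. g - x) ` C = {}" using assms by fastforce
  hence "card (C \<union> (\<lambda>x. g - x) ` C) = 2 * card C"
    by (simp add: card_Un_disjoint card_image inj_on_def)
  moreover have "card (C \<union> (\<lambda>x. g - x) ` C) \<le> card (UNIV :: 'a set)"
    by (intro card_mono) auto
  ultimately show ?thesis by linarith
qed

lemma card_le_half_if_sumset_2:
  fixes B :: "'a::{ab_group_add,finite} set"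
  assumes "sumset B 2 \<noteq> UNIV"
  shows "card (insert 0 B) \<le> card (UNIV :: 'a set) div 2"
proof -
  obtain g where "g \<notin> sumset B 2" using assms by blast
  thus ?thesis by (intro card_le_half[of _ g]) (auto simp: sumset_2)
qed

text \<open>If doubling is bijective, \<open>x \<mapsto> g - x\<close> has exactly one fixed point \<open>x\<^sub>0\<close>, so a maximal set
  without solutions of \<open>u + v = g\<close> misses only its reflection and \<open>x\<^sub>0\<close>.\<close>

lemma half_set_if_doubling_surj:
  fixes A :: "'a::{ab_group_add,finite} set"
  assumes A: "generates A" "sumset A 2 \<noteq> UNIV" and surj: "surj (\<lambda>x :: 'a. x + x)"
  shows "\<exists>C :: 'a set. generates C \<and> sumset C 2 \<noteq> UNIV \<and> aperiodic C
    \<and> card C = card (UNIV :: 'a set) div 2"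
proof -
  obtain g where g: "g \<notin> sumset A 2" using A(2) by blast
  \<comment> \<open>Members of \<open>F\<close> contain \<open>A\<close> and so generate, and their
    twofold sumsets still miss \<open>g\<close>.\<close>
  define F where "F = {C. insert 0 A \<subseteq> C \<and> (\<forall>u\<in>C. \<forall>v\<in>C. u + v \<noteq> g)}"
  have "insert 0 A \<in> F" using g by (auto simp: F_def sumset_2)
  then obtain C where C: "C \<in> F" "\<And>D. D \<in> F \<Longrightarrow> C \<subseteq> D \<Longrightarrow> C = D"
    using finite_has_maximal[of F] by (metis empty_iff finite)
  have inj: "inj (\<lambda>x :: 'a. x + x)" using surj by (simp add: finite_UNIV_surj_inj)
  obtain x0 where x0: "x0 + x0 = g" using surj by (metis surjD)
  have C0: "0 \<in> C" and AC: "A \<subseteq> C" and Cg: "\<And>u v. u \<in> C \<Longrightarrow> v \<in> C \<Longrightarrow> u + v \<noteq> g"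
    using C(1) by (auto simp: F_def)
  have x0C: "x0 \<notin> C" using Cg x0 by blast
  let ?R = "(\<lambda>x. g - x) ` C"
  have x0R: "x0 \<notin> ?R"
  proof
    assume "x0 \<in> ?R"
    then obtain c where "c \<in> C" "x0 = g - c" by blast
    moreover from this have "c = g - x0" by (simp add: algebra_simps)
    moreover have "g - x0 = x0" by (simp flip: x0)
    ultimately show False using x0C by metis
  qed
  \<comment> \<open>An element outside \<open>C\<close> and its reflection, other than
    \<open>x0\<close>, could be added to \<open>C\<close>.\<close>
  have cover: "x \<in> C \<or> x \<in> ?R" if "x \<noteq> x0" for x
  proof (rule ccontr)
    assume x: "\<not> ?thesis"
    have "x + x \<noteq> g" using that inj x0 by (auto dest: injD)
    moreover have "c + x \<noteq> g" "x + c \<noteq> g" if "c \<in> C" for c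
      using x that by (auto simp: image_iff algebra_simps)
    ultimately have "insert x C \<in> F" using C0 AC Cg by (auto simp: F_def)
    thus False using C(2)[of "insert x C"] x by blast
  qed
  have "C \<inter> ?R = {}" using Cg by fastforce
  hence "card (C \<union> ?R) = 2 * card C"
    by (simp add: card_Un_disjoint card_image inj_on_def)
  moreover have "UNIV = insert x0 (C \<union> ?R)" using cover by blast
  ultimately have "card (UNIV :: 'a set) = Suc (2 * card C)"
    using x0C x0R by (metis Un_iff card_insert_disjoint finite)
  hence card: "card C = card (UNIV :: 'a set) div 2" by simp
  have "g \<notin> sumset C 2" using Cg C0 by (auto simp: sumset_2 insert_absorb)
  hence diam: "sumset C 2 \<noteq> UNIV" by blast
  have "aperiodic C"
  proof (rule aperiodicI, rule ccontr)
    fix p assume p: "(\<lambda>x. x + p) ` C = C" "p \<noteq> 0"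
    \<comment> \<open>A period of \<open>C\<close> also preserves the reflection, so it would have
      to fix \<open>x0\<close>, the only element outside both.\<close>
    from p(2) have "x0 + p \<in> C \<or> x0 + p \<in> ?R" by (intro cover) simp
    thus False
    proof
      assume "x0 + p \<in> C"
      then obtain c where "c \<in> C" "x0 + p = c + p" using p(1) by (metis imageE)
      thus False using x0C by simp
    next
      assume "x0 + p \<in> ?R"
      then obtain c where c: "c \<in> C" "x0 + p = g - c" by blast
      hence "x0 = g - (c + p)" by (simp add: algebra_simps)
      moreover have "c + p \<in> C" using c(1) p(1) by blast
      ultimately show False using x0R by blast
    qed
  qed
  thus ?thesis using generates_mono[OF A(1) AC] diam card by blast
qed

text \<open>A subgroup \<open>H\<close> maximal among those containing all doubles and omitting
  \<open>g\<close> works: if \<open>x\<close> and \<open>g - x\<close> were both outside, the coset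
  of \<open>x\<close> could be adjoined.\<close>

lemma index_2_subgrp:
  fixes g :: "'a::{ab_group_add,finite}"
  assumes g: "\<And>x. x + x \<noteq> g"
  obtains H where "subgrp H" "\<And>x. x \<in> H \<longleftrightarrow> g - x \<notin> H" "card (UNIV :: 'a set) = 2 * card H"
proof -
  define F where "F = {H. subgrp H \<and> g \<notin> H \<and> (\<forall>x. x + x \<in> H)}"
  have "range (\<lambda>x :: 'a. x + x) \<in> F"
  proof -
    have "subgrp (range (\<lambda>x :: 'a. x + x))"
    proof (rule subgrpI_finite)
      show "0 \<in> range (\<lambda>x :: 'a. x + x)" by (rule image_eqI[of _ _ 0]) auto
      fix x y :: 'a
      assume "x \<in> range (\<lambda>x. x + x)" "y \<in> range (\<lambda>x. x + x)"
      then obtain u v where "x = u + u" "y = v + v" by blast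
      hence "x + y = (u + v) + (u + v)" by (simp add: algebra_simps)
      thus "x + y \<in> range (\<lambda>x. x + x)" by blast
    qed
    thus ?thesis using g by (auto simp: F_def)
  qed
  then obtain H where H: "H \<in> F" "\<And>K. K \<in> F \<Longrightarrow> H \<subseteq> K \<Longrightarrow> H = K"
    using finite_has_maximal[of F] by (metis empty_iff finite)
  have sub: "subgrp H" and gH: "g \<notin> H" and dbl: "\<And>x. x + x \<in> H"
    using H(1) by (auto simp: F_def)
  have "g - x \<in> H" if "x \<notin> H" for x
  proof (rule ccontr)
    assume gx: "g - x \<notin> H"
    \<comment> \<open>The union of \<open>H\<close> and its coset of \<open>x\<close>, closed under
      addition because \<open>x + x\<close> lies in \<open>H\<close>; it omits \<open>g\<close>
      because \<open>g - x\<close> is not in \<open>H\<close>.\<close>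
    define K where "K = {y. y \<in> H \<or> y - x \<in> H}"
    have "subgrp K"
    proof (rule subgrpI_finite)
      show "0 \<in> K" using sub by (simp add: K_def subgrp_0)
      fix y z assume yz: "y \<in> K" "z \<in> K"
      have *: "y + z \<in> K" if "y \<in> H" "z - x \<in> H" for y z
        using subgrp_add[OF sub that] by (simp add: K_def algebra_simps)
      have "y + z \<in> H" if "y - x \<in> H" "z - x \<in> H"
        using subgrp_add[OF sub subgrp_add[OF sub that] dbl[of x]] by (simp add: algebra_simps)
      thus "y + z \<in> K"
        using yz *[of y z] *[of z y] subgrp_add[OF sub, of y z] by (auto simp: K_def add.commute)
    qed
    hence "K \<in> F" using gx gH dbl by (auto simp: F_def K_def)
    moreover have "H \<subseteq> K" by (auto simp: K_def)
    moreover have "x \<in> K" using sub by (simp add: K_def subgrp_0)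
    ultimately show False using H(2) \<open>x \<notin> H\<close> by blast
  qed
  moreover have "g - x \<notin> H" if "x \<in> H" for x
    using subgrp_add[OF sub that, of "g - x"] gH by auto
  ultimately have iff: "x \<in> H \<longleftrightarrow> g - x \<notin> H" for x by blast
  have "UNIV = H \<union> (\<lambda>x. g - x) ` H"
  proof -
    have "x \<in> (\<lambda>x. g - x) ` H" if "x \<notin> H" for x
      using that iff[of x] by (intro image_eqI[of _ _ "g - x"]) auto
    thus ?thesis by blast
  qed
  moreover have "H \<inter> (\<lambda>x. g - x) ` H = {}" using iff by blast
  ultimately have "card (UNIV :: 'a set) = card H + card ((\<lambda>x. g - x) ` H)"
    using card_Un_disjoint[of H "(\<lambda>x. g - x) ` H"] by simp
  hence "card (UNIV :: 'a set) = 2 * card H" by (simp add: card_image inj_on_def)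
  thus ?thesis using that sub iff by blast
qed

text \<open>If \<open>g\<close> is not a double, exchange one element \<open>h\<close> of an index-2 subgroup for \<open>g - h\<close>.\<close>

lemma half_set_if_not_double:
  fixes g :: "'a::{ab_group_add,finite}"
  assumes g: "\<And>x. x + x \<noteq> g" and card: "card (UNIV :: 'a set) > 4"
  shows "\<exists>C :: 'a set. generates C \<and> sumset C 2 \<noteq> UNIV \<and> aperiodic C
    \<and> card C = card (UNIV :: 'a set) div 2"
proof -
  obtain H where H: "subgrp H" and iff: "\<And>x. x \<in> H \<longleftrightarrow> g - x \<notin> H"
    and cardH: "card (UNIV :: 'a set) = 2 * card H"
    using index_2_subgrp[OF g] by blast
  have gH: "g \<notin> H" using iff[of 0] subgrp_0[OF H] by simp
  \<comment> \<open>\<open>H\<close> has more than two elements, which leaves room for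
    \<open>h\<close> and a further nonzero \<open>h'\<close>.\<close>
  have exH: "\<exists>h\<in>H. h \<notin> S" if "card S \<le> 2" for S
  proof (rule ccontr)
    assume "\<not> ?thesis"
    hence "card H \<le> card S" by (intro card_mono) auto
    thus False using that card cardH by linarith
  qed
  obtain h where h: "h \<in> H" "h \<noteq> 0" using exH[of "{0}"] by auto
  obtain h' where h': "h' \<in> H" "h' \<noteq> 0" "h' \<noteq> h"
    using exH[of "{0, h}"] card_insert_le_m1[of 2 "{h}" 0] by auto
  define C where "C = insert (g - h) (H - {h})"
  have ghH: "g - h \<notin> H" using iff h(1) by blast
  have "card H > 0" using h(1) by (auto simp: card_gt_0_iff)
  hence cardC: "card C = card H" using ghH h(1) by (simp add: C_def)
  have C0: "0 \<in> C" using h(2) subgrp_0[OF H] by (simp add: C_def)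
  have "generates C"
    unfolding generates_iff
  proof clarify
    fix K assume K: "C \<subseteq> K" "subgrp K"
    \<comment> \<open>The removed element is recovered as \<open>h' + (h - h')\<close>, both
      summands being kept in \<open>C\<close>.\<close>
    have "h' \<in> K" using K(1) h' by (auto simp: C_def)
    moreover have "h - h' \<in> K"
      using K(1) h' subgrp_diff[OF H h(1) h'(1)] by (auto simp: C_def)
    ultimately have "h \<in> K" using subgrp_add[OF K(2), of h' "h - h'"] by simp
    hence HK: "H \<subseteq> K" using K(1) by (auto simp: C_def)
    have gK: "g \<in> K"
      using subgrp_add[OF K(2) _ \<open>h \<in> K\<close>, of "g - h"] K(1) by (auto simp: C_def)
    have "x \<in> K" for x
    proof (cases "x \<in> H")
      case False
      hence "g - x \<in> K" using iff HK by blast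
      thus ?thesis using subgrp_diff[OF K(2) gK, of "g - x"] by simp
    qed (use HK in blast)
    thus "K = UNIV" by blast
  qed
  moreover have "g \<notin> sumset C 2"
  proof
    assume "g \<in> sumset C 2"
    then obtain u v where uv: "u \<in> C" "v \<in> C" "g = u + v"
      using C0 by (auto simp: sumset_2 insert_absorb)
    have "\<not> (u \<in> H \<and> v \<in> H)" using subgrp_add[OF H] gH uv(3) by blast
    moreover have "\<not> (u \<in> H \<and> v = g - h)" "\<not> (v \<in> H \<and> u = g - h)"
      using uv ghH by (auto simp: C_def algebra_simps)
    moreover have "\<not> (u = g - h \<and> v = g - h)"
    proof
      assume "u = g - h \<and> v = g - h"
      hence "g = (g - h) + (g - h)" using uv(3) by metis
      hence "h + h = g" by (simp add: algebra_simps)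
      thus False using g by blast
    qed
    ultimately show False using uv(1,2) by (auto simp: C_def)
  qed
  moreover have "aperiodic C"
  proof (rule aperiodicI, rule ccontr)
    fix p assume p: "(\<lambda>x. x + p) ` C = C" "p \<noteq> 0"
    have pC: "x + p \<in> C" if "x \<in> C" for x using p(1) that by blast
    \<comment> \<open>Only \<open>g - h\<close> lies in \<open>C\<close> outside \<open>H\<close>. A
      period in \<open>H\<close> would move it to another such element; a period outside
      \<open>H\<close> would send both \<open>0\<close> and \<open>h'\<close> to it.\<close>
    show False
    proof (cases "p \<in> H")
      case True
      have "g - h + p \<in> C" by (intro pC) (simp add: C_def)
      moreover have "g - h + p \<notin> H"
        using ghH subgrp_add_cancel_right[OF H True] by blast
      ultimately show False using p(2) by (auto simp: C_def)
    next
      case False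
      have "x + p = g - h" if "x \<in> H" "x \<noteq> h" for x
      proof -
        have "x + p \<in> C" using that by (intro pC) (simp add: C_def)
        moreover have "x + p \<notin> H"
          using False subgrp_add_cancel_left[OF H that(1)] by blast
        ultimately show ?thesis by (auto simp: C_def)
      qed
      from this[of 0] this[of h'] show False using h h' subgrp_0[OF H] by auto
    qed
  qed
  ultimately show ?thesis using cardC cardH by auto
qed

lemma half_set:
  fixes A :: "'a::{ab_group_add,finite} set"
  assumes A: "generates A" "sumset A 2 \<noteq> UNIV"
  shows "\<exists>C :: 'a set. generates C \<and> sumset C 2 \<noteq> UNIV \<and> aperiodic C
    \<and> card C = card (UNIV :: 'a set) div 2"
proof (cases "surj (\<lambda>x :: 'a. x + x)")
  case True
  thus ?thesis using half_set_if_doubling_surj[OF A] by blast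
next
  case False
  then obtain g where g: "\<And>x :: 'a. x + x \<noteq> g" by (metis surjI)
  show ?thesis
  proof (cases "card (UNIV :: 'a set) > 4")
    case True
    thus ?thesis using half_set_if_not_double[OF g] by blast
  next
    \<comment> \<open>Here \<open>?C\<close> has at most two elements, so it is
      \<open>{0, a}\<close> in a group of order 4. A nonzero period would be \<open>a\<close>,
      making \<open>?C\<close> a subgroup and thus the whole group.\<close>
    case small: False
    let ?C = "insert 0 A"
    have le: "card ?C \<le> card (UNIV :: 'a set) div 2" using A(2) by (rule card_le_half_if_sumset_2)
    hence le2: "card ?C \<le> 2" using small by linarith
    have genC: "generates ?C" using A(1) generates_mono by blast
    have closed: "sumset A 2 = UNIV" if "\<And>x y. x \<in> ?C \<Longrightarrow> y \<in> ?C \<Longrightarrow> x + y \<in> ?C"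
    proof -
      have "subgrp ?C" using that by (intro subgrpI_finite) blast+
      hence "?C = UNIV" using genC generates_iff by blast
      thus ?thesis using sumset_mono[of 1 2 A A] unfolding sumset_1 by auto
    qed
    obtain a where a: "a \<in> A" "a \<noteq> 0"
      using closed A(2) by fastforce
    have "card {0, a} = 2" using a(2) by simp
    hence C: "?C = {0, a}"
      using card_seteq[of ?C "{0, a}"] le2 a(1) by auto
    have "card ?C = card (UNIV :: 'a set) div 2"
      using le small a(2) unfolding C by simp
    moreover have "aperiodic ?C"
    proof (rule aperiodicI, rule ccontr)
      fix p assume p: "(\<lambda>x. x + p) ` ?C = ?C" "p \<noteq> 0"
      hence pC: "x + p \<in> ?C" if "x \<in> ?C" for x using that by blast
      have "p = a" using pC[of 0] p(2) unfolding C by auto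
      hence "a + a \<in> {0, a}" using pC[of a] unfolding C by auto
      hence "a + a = 0" using a(2) by auto
      hence "sumset A 2 = UNIV" by (intro closed) (auto simp: C)
      thus False using A(2) by blast
    qed
    ultimately show ?thesis using genC A(2) by (metis sumset_insert_0)
  qed
qed

lemma period_shift: "(\<lambda>x. x + p) ` S = S \<Longrightarrow> x + p \<in> S \<longleftrightarrow> x \<in> (S :: 'a::ab_group_add set)"
  by (metis (no_types, lifting) add_right_imp_eq image_iff)

text \<open>A nonzero period of \<open>A\<close> makes one of its nonzero elements redundant.\<close>

lemma aperiodic_if_card_eq_rk:
  fixes G :: "'a::{ab_group_add,finite} itself" and A :: "'a set"
  assumes A: "generates A" "0 \<in> A" "card A = rk G + 1" "A \<noteq> UNIV"
  shows "aperiodic A"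
proof (rule aperiodicI, rule ccontr)
  fix p assume p: "(\<lambda>x. x + p) ` A = A" "p \<noteq> 0"
  note shift = period_shift[OF p(1)]
  have pA: "p \<in> A" using shift[of 0] A(2) by simp
  have mA: "- p \<in> A" using shift[of "- p"] A(2) by simp
  \<comment> \<open>No nonzero \<open>x\<close> in \<open>A\<close> is generated by the others:
    without \<open>0\<close> and \<open>x\<close>, only \<open>rk G - 1\<close> elements
    remain.\<close>
  have irred: False
    if x: "x \<in> A" "x \<noteq> 0" "\<And>K. subgrp K \<Longrightarrow> A - {0, x} \<subseteq> K \<Longrightarrow> x \<in> K" for x
  proof -
    have "generates (A - {0, x})"
      unfolding generates_iff
    proof clarify
      fix K assume K: "A - {0, x} \<subseteq> K" "subgrp K"
      hence "A \<subseteq> K" using x(3)[of K] subgrp_0[of K] by blast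
      thus "K = UNIV" using A(1) K(2) generates_iff by blast
    qed
    hence "rk G \<le> card (A - {0, x})" by (rule rk_le)
    also have "card (A - {0, x}) = card A - 2"
      using x A(2) by (subst card_Diff_subset) auto
    \<comment> \<open>With truncated subtraction, \<open>rk G \<le> rk G + 1 - 2\<close> is possible
      only for rank 0.\<close>
    finally have "card A = 1" using A(3) by simp
    then obtain c where "A = {c}" by (metis card_1_singletonE)
    thus False using A(2) x(1,2) by auto
  qed
  show False
  \<comment> \<open>If \<open>- p\<close> differs from \<open>p\<close>, it is redundant. If
    \<open>p\<close> has order 2, then \<open>x + p\<close> is redundant for any further
    \<open>x\<close>; with no such \<open>x\<close>, the set \<open>{0, p}\<close> is itself a
    subgroup.\<close>
  proof (cases "- p = p")
    case False
    show False
    proof (rule irred[of "- p"])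
      fix K assume "subgrp K" "A - {0, - p} \<subseteq> K"
      thus "- p \<in> K" using pA p(2) False by (intro subgrp_minus) auto
    qed (use mA p(2) in auto)
  next
    case True
    hence pp: "p + p = 0" by (metis add.left_inverse)
    show False
    proof (cases "A = {0, p}")
      case False
      then obtain x where x: "x \<in> A" "x \<noteq> 0" "x \<noteq> p" using pA A(2) by blast
      show False
      proof (rule irred[of "x + p"])
        show "x + p \<in> A" using shift x(1) by blast
        show "x + p \<noteq> 0" using x(3) True by (metis add_eq_0_iff2)
        fix K assume "subgrp K" "A - {0, x + p} \<subseteq> K"
        thus "x + p \<in> K" using x pA p(2) by (intro subgrp_add) auto
      qed
    next
      case eq: True
      have "subgrp A" unfolding eq by (rule subgrpI_finite) (use pp in auto)
      thus False using A(1,4) generates_iff by blast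
    qed
  qed
qed

section \<open>The values in the four cases\<close>

lemma enat_le_diam_plus:
  fixes G :: "'a::{ab_group_add,finite} itself"
  assumes "enat (Suc k) \<le> diam_plus G"
  obtains A :: "'a set" where "generates A" "sumset A k \<noteq> UNIV"
  using diam_plus_attained[of G] assms le_diamA_iff by metis

text \<open>In a nontrivial group every subset has diameter at least 1, so the only 1-maximal set is
  the whole group, which is periodic.\<close>

lemma t_1_s_1:
  fixes G :: "'a::{ab_group_add,finite} itself"
  assumes "1 \<le> diam_plus G"
  shows "t_rho G 1 = 0 \<and> s_rho G 1 = card (UNIV :: 'a set)"
proof -
  obtain A :: "'a set" where "sumset A 0 \<noteq> UNIV"
    by (rule enat_le_diam_plus[of 0 G]) (use assms in \<open>simp add: one_enat_def\<close>)
  then obtain g :: 'a where g: "g \<noteq> 0" by (auto simp: sumset_0)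
  hence one: "enat 1 \<le> diamA B" for B :: "'a set"
    using le_diamA_iff[of 0 B] by (auto simp: sumset_0)
  have "\<not> (aperiodic A \<and> rho_maximal 1 A)" for A :: "'a set"
  proof
    assume A: "aperiodic A \<and> rho_maximal 1 A"
    hence "A = UNIV" using one[of UNIV] by (auto simp: rho_maximal_def)
    moreover have "g \<in> period UNIV" by (auto simp: period_def)
    ultimately show False using A g by (auto simp: aperiodic_def)
  qed
  \<comment> \<open>No set qualifies, so the value 0 is the convention for an empty maximum.\<close>
  hence "{card (A :: 'a set) | A. aperiodic A \<and> rho_maximal 1 A \<and> generates A} = {}" by blast
  hence "t_rho G 1 = 0" unfolding t_rho_def by (simp only: Un_empty_left Max_singleton)
  moreover have "s_rho G 1 = card (UNIV :: 'a set)"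
    unfolding s_rho_def
  proof (rule Max_eqI)
    show "card (UNIV :: 'a set) \<in> {card A |A :: 'a set. enat 1 \<le> diamA A \<and> diamA A < \<infinity>} \<union> {0}"
      using one[of UNIV] generates_UNIV[where 'a = 'a] generates_iff_diamA by blast
  qed (auto intro: card_mono)
  ultimately show ?thesis by blast
qed

text \<open>The complement of a point \<open>g\<close> is extremal, and a translation preserving it
  would fix \<open>g\<close>. Choosing \<open>g\<close> outside a generating set lets the complement
  generate.\<close>

lemma t_2_s_2:
  fixes G :: "'a::{ab_group_add,finite} itself"
  assumes "2 \<le> diam_plus G"
  shows "t_rho G 2 = card (UNIV :: 'a set) - 1 \<and> s_rho G 2 = card (UNIV :: 'a set) - 1"
proof -
  have iff: "enat 2 \<le> diamA B \<longleftrightarrow> insert 0 B \<noteq> UNIV" for B :: "'a set"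
    using le_diamA_iff[of 1 B] unfolding sumset_1 by (simp add: numeral_2_eq_2)
  obtain A :: "'a set" where A: "generates A" "insert 0 A \<noteq> UNIV"
    using enat_le_diam_plus[of 1 G] assms unfolding sumset_1 by (auto simp: numeral_eq_enat numeral_2_eq_2)
  then obtain g where g: "g \<notin> insert 0 A" by blast
  define C where "C = UNIV - {g}"
  have "generates C" using A(1) g by (auto simp: C_def intro: generates_mono)
  moreover have "enat 2 \<le> diamA C" using g by (auto simp: iff C_def)
  moreover have "aperiodic C"
  proof (rule aperiodicI, rule ccontr)
    fix p assume p: "(\<lambda>x. x + p) ` C = C" "p \<noteq> 0"
    thus False using period_shift[OF p(1), of "g - p"] by (auto simp: C_def)
  qed
  moreover have cardC: "card C = card (UNIV :: 'a set) - 1" by (simp add: C_def)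
  moreover have "card B \<le> card C" if "enat 2 \<le> diamA B" for B :: "'a set"
  proof -
    have "card (insert 0 B) < card (UNIV :: 'a set)"
      using that unfolding iff by (intro psubset_card_mono) auto
    moreover have "card B \<le> card (insert 0 B)" by (intro card_mono) auto
    ultimately show ?thesis unfolding cardC by linarith
  qed
  ultimately show ?thesis using t_rho_s_rho_eqI[of C 2 G] by simp
qed

lemma t_3_s_3:
  fixes G :: "'a::{ab_group_add,finite} itself"
  assumes "3 \<le> diam_plus G"
  shows "t_rho G 3 = card (UNIV :: 'a set) div 2 \<and> s_rho G 3 = card (UNIV :: 'a set) div 2"
proof -
  have iff: "enat 3 \<le> diamA B \<longleftrightarrow> sumset B 2 \<noteq> UNIV" for B :: "'a set"
    using le_diamA_iff[of 2 B] by simp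
  obtain A :: "'a set" where A: "generates A" "sumset A 2 \<noteq> UNIV"
    using enat_le_diam_plus[of 2 G] assms by (auto simp: numeral_eq_enat)
  obtain C :: "'a set" where C: "generates C" "sumset C 2 \<noteq> UNIV" "aperiodic C"
    "card C = card (UNIV :: 'a set) div 2"
    using half_set[OF A] by blast
  have "card B \<le> card C" if "enat 3 \<le> diamA B" for B :: "'a set"
  proof -
    have "card B \<le> card (insert 0 B)" by (intro card_mono) auto
    also have "\<dots> \<le> card C"
      unfolding C(4) using that iff by (intro card_le_half_if_sumset_2) blast
    finally show ?thesis .
  qed
  thus ?thesis using t_rho_s_rho_eqI[of C 3 G] C iff by simp
qed

text \<open>Adjoining 0 changes no sumset, while a set of full diameter has at most
  \<open>rk G\<close> nonzero elements. So an extremal set with 0 adjoined has exactly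
  \<open>rk G + 1\<close>.\<close>

lemma t_s_diam_plus:
  fixes G :: "'a::{ab_group_add,finite} itself"
  assumes \<rho>: "enat \<rho> = diam_plus G" "2 \<le> \<rho>"
  shows "t_rho G \<rho> = rk G + 1 \<and> s_rho G \<rho> = rk G + 1"
proof -
  have le: "card (B - {0}) \<le> rk G" if "generates B" "enat \<rho> \<le> diamA B" for B :: "'a set"
  proof (rule ccontr)
    assume "\<not> ?thesis"
    hence "diamA (B - {0}) < diam_plus G"
      using that(1) by (intro diamA_less_if_rk_less_card generates_remove_0) auto
    moreover have "diamA (B - {0}) = diamA B"
      unfolding diamA_def using sumset_insert_0[of B] sumset_insert_0[of "B - {0}"] by simp
    ultimately show False using that(2) \<rho>(1) by simp
  qed
  have card_le: "card B \<le> rk G + 1" if "generates B" "enat \<rho> \<le> diamA B" for B :: "'a set"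
  proof -
    have "card B \<le> card (insert 0 (B - {0}))" by (intro card_mono) auto
    also have "\<dots> = Suc (card (B - {0}))" by (rule card_insert_disjoint) auto
    finally show ?thesis using le[OF that] by linarith
  qed
  obtain A :: "'a set" where A: "generates A" "diamA A = diam_plus G"
    using diam_plus_attained .
  define C where "C = insert 0 A"
  have genC: "generates C" using A(1) generates_mono unfolding C_def by blast
  have "diamA C = diamA A" by (simp add: diamA_def C_def sumset_insert_0)
  hence diamC: "enat \<rho> \<le> diamA C" using A(2) \<rho>(1) by simp
  have "rk G \<le> card (C - {0})" using genC by (intro rk_le generates_remove_0)
  moreover have "card C = Suc (card (C - {0}))" by (rule card_Suc_Diff1[symmetric]) (auto simp: C_def)
  ultimately have cardC: "card C = rk G + 1" using card_le[OF genC diamC] by linarith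
  \<comment> \<open>Diameter at least 2 keeps \<open>C\<close> from being the whole group, which
    would be periodic.\<close>
  have "enat (Suc 1) \<le> enat \<rho>" using \<rho>(2) by simp
  hence "enat (Suc 1) \<le> diamA C" using diamC by (rule order_trans)
  hence "C \<noteq> UNIV" unfolding le_diamA_iff sumset_1 by (auto simp: C_def)
  hence "aperiodic C" using aperiodic_if_card_eq_rk[OF genC _ cardC] by (simp add: C_def)
  thus ?thesis using t_rho_s_rho_eqI[of C \<rho> G] genC diamC card_le cardC by simp
qed

theorem theorem2p4:
  fixes G :: "'a::{ab_group_add,finite} itself"
  shows "(1 \<le> diam_plus G \<longrightarrow> t_rho G 1 = 0 \<and> s_rho G 1 = card (UNIV::'a set))
       \<and> (2 \<le> diam_plus G \<longrightarrow> t_rho G 2 = card (UNIV::'a set) - 1 \<and> s_rho G 2 = card (UNIV::'a set) - 1)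
       \<and> (3 \<le> diam_plus G \<longrightarrow> t_rho G 3 = card (UNIV::'a set) div 2 \<and> s_rho G 3 = card (UNIV::'a set) div 2)
       \<and> (\<forall>\<rho>::nat. enat \<rho> = diam_plus G \<and> 2 \<le> \<rho> \<longrightarrow>
            t_rho G \<rho> = rk G + 1 \<and> s_rho G \<rho> = rk G + 1)"
  using t_1_s_1[of G] t_2_s_2[of G] t_3_s_3[of G] t_s_diam_plus[of _ G] by blast

end
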